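(* Consider $\phi_*=\min_{x\in\mathbb{R}^n}\{\phi(x):=f(x)+h(x)\}$ under the assumptions in the context, and let $R_0=\min\{\|w_0-x\|:x\in X_*\}$, where $X_*$ is the set of minimizers of $\phi$ and $w_0\in\operatorname{dom}h$ is the initial point of the Restarted ACG algorithm (defined in the context, with parameters $\lambda>0$, $\sigma\in(0,1)$). Let $\varepsilon>0$. The total iteration-complexity is the total number of ACG iterations, summed over all inner calls, performed until $w_k$ is an $\varepsilon$-solution, i.e. $\phi(w_k)-\phi_*\le\varepsilon$. (a) If $\mu_f=0$ and $1/L_f\le\lambda\le R_0^2/\varepsilon$, then the total iteration-complexity of Restarted ACG to find an $\varepsilon$-solution is $\tilde{\mathcal O}\big(R_0\sqrt{L_f/\varepsilon}\big)$. (b) If $\mu_f>0$ and $1/(L_f-\mu_f)\le\lambda\le\min\{1/\mu_f,\,R_0^2/\varepsilon\}$, then the total iteration-complexity of Restarted ACG to find an $\varepsilon$-solution is $\tilde{\mathcal O}\big(\min\{\sqrt{L_f/\mu_f},\,R_0\sqrt{L_f/\varepsilon}\}\big)$.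
   Context: Assumptions. $f$ is proper closed, $\mu_f$-strongly convex ($\mu_f=0$ meaning convex) and $L_f$-smooth on $\mathbb{R}^n$ ($\nabla f$ is $L_f$-Lipschitz), with $L_f>0$ and $L_f\ge2\mu_f\ge0$; $h$ is proper closed convex with computable proximal mapping, $\operatorname{dom}h\subset\operatorname{dom}f$; $X_*\ne\emptyset$. For differentiable $g$, $\ell_g(u;x)=g(x)+\langle\nabla g(x),u-x\rangle$. $\tilde{\mathcal O}$ suppresses absolute constants, constants depending only on $\sigma$, and logarithmic factors in the problem and algorithm parameters. ACG. Applied to $\psi=g+h$ with $g$ $\mu$-strongly convex and $(L+\mu)$-smooth, from $x_0\in\operatorname{dom}\psi$. Set $A_0=0$, $\tau_0=1$, $y_0=x_0$. ACG iteration $j=0,1,\dots$: $a_j=\frac{\tau_j+\sqrt{\tau_j^2+8\tau_jA_jL}}{4L}$, $A_{j+1}=A_j+a_j$, $\tau_{j+1}=\tau_j+\mu a_j$, $\tilde x_j=\frac{A_j}{A_{j+1}}y_j+\frac{a_j}{A_{j+1}}x_j$; $\tilde y_{j+1}=\operatorname{argmin}_u\{\ell_g(u;\tilde x_j)+h(u)+\frac{2L+\mu}{2}\|u-\tilde x_j\|^2\}$; $y_{j+1}$ is a point of $\{y_j,\tilde y_{j+1}\}$ with smallest $\psi$-value; $x_{j+1}=\frac{(2L+\mu)a_j\tilde y_{j+1}-\frac{2A_ja_jL}{A_{j+1}}y_j}{A_{j+1}\mu+1}$. Associated quantities: $\Gamma_j(x)=\ell_g(x;\tilde x_j)+h(x)+\frac{2L+\mu}{2}\|x-\tilde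 x_j\|^2$, $u_{j+1}=2L(\tilde x_j-\tilde y_{j+1})$, $\theta_{j+1}(x)=\Gamma_j(\tilde y_{j+1})-L\|\tilde y_{j+1}-\tilde x_j\|^2+\langle u_{j+1},x-\tilde y_{j+1}\rangle+\frac\mu2\|x-\tilde y_{j+1}\|^2$, $\Theta_0\equiv0$, $\Theta_{j+1}=\frac{A_j\Theta_j+a_j\theta_{j+1}}{A_{j+1}}$, and $s_j=\frac{x_0-x_j}{A_j}$ for $j\ge1$. Restarted ACG. Input $w_0\in\operatorname{dom}h$, $\sigma\in(0,1)$, $\lambda>0$, $L_f,\mu_f$. Set $B_0=0$, $\tau_0=1$, $v_0=w_0$ (the outer scalars $\tau_k$ are distinct from the inner ACG scalars). For $k=0,1,\dots$: 1. $b_k=\frac{\tau_k\lambda+\sqrt{\tau_k^2\lambda^2+4\tau_k\lambda B_k}}{2}$, $B_{k+1}=B_k+b_k$, $\tau_{k+1}=\tau_k+b_k\mu_f$, $\tilde v_k=\frac{B_k}{B_{k+1}}w_k+\frac{b_k}{B_{k+1}}v_k$. 2. Run ACG with $x_0=\tilde v_k$, $g(\cdot)=f(\cdot)+\frac1{2\lambda}\|\cdot-\tilde v_k\|^2$, $\psi=g+h$, $\mu=\mu_f+\frac1\lambda$, $L=L_f-\mu_f$, until the first $j\ge1$ with $\|\lambda s_j\|^2+2\lambda[\psi(y_j)-\Theta_j(x_j)]\le\sigma\|y_j-x_0\|^2$. 3. Choose $w_{k+1}\in\operatorname{Argmin}\{\phi(u):u\in\{w_k,y_j\}\}$ and set $v_{k+1}=\frac1{\tau_{k+1}}\big(\tau_kv_k+b_k\mu_fx_j-b_k\frac{A_j+\lambda}{\lambda}s_j\big)$.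 *)

theory Defs
  imports "HOL-Analysis.Analysis"
begin

text \<open>
  The constants hidden in the complexity bounds must not depend on the dimension, so the dimension
  has to be quantified inside the statement, which is impossible for a type such as
  \<open>real ^ 'n\<close>.  All the spaces $R^n$ are therefore placed in one inner product space, the finitely
  supported real sequences; \<open>Rn n\<close> is the subspace of sequences supported on the indices below
  \<open>n\<close>, and on it the inner product is the usual Euclidean one (lemma \<open>inner_Rn\<close>).
\<close>

typedef fvec = "{x :: nat \<Rightarrow> real. finite {i. x i \<noteq> 0}}"
  morphisms coord Abs_fvec
  by (rule exI[of _ "\<lambda>_. 0"]) simp

lemma finite_coord [simp]: "finite {i. coord x i \<noteq> 0}"
  using coord[of x] by simp

lemma coord_Abs: "finite {i. x i \<noteq> 0} \<Longrightarrow> coord (Abs_fvec x) = x"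
  by (simp add: Abs_fvec_inverse)

lemma fvec_eqI: "(\<And>i. coord x i = coord y i) \<Longrightarrow> x = y"
  by (metis coord_inject ext)

instantiation fvec :: real_vector
begin

definition "0 = Abs_fvec (\<lambda>_. 0)"
definition "x + y = Abs_fvec (\<lambda>i. coord x i + coord y i)"
definition "- x = Abs_fvec (\<lambda>i. - coord x i)"
definition "x - y = Abs_fvec (\<lambda>i. coord x i - coord y i)"
definition "r *\<^sub>R x = Abs_fvec (\<lambda>i. r * coord x i)"

lemma coord_zero [simp]: "coord 0 i = 0"
  by (simp add: zero_fvec_def coord_Abs)

lemma coord_add [simp]: "coord (x + y) i = coord x i + coord y i"
proof -
  have "finite {i. coord x i + coord y i \<noteq> 0}"
    by (rule finite_subset[of _ "{i. coord x i \<noteq> 0} \<union> {i. coord y i \<noteq> 0}"]) auto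
  then show ?thesis by (simp add: plus_fvec_def coord_Abs)
qed

lemma coord_minus [simp]: "coord (- x) i = - coord x i"
  by (simp add: uminus_fvec_def coord_Abs)

lemma coord_diff [simp]: "coord (x - y) i = coord x i - coord y i"
proof -
  have "finite {i. coord x i - coord y i \<noteq> 0}"
    by (rule finite_subset[of _ "{i. coord x i \<noteq> 0} \<union> {i. coord y i \<noteq> 0}"]) auto
  then show ?thesis by (simp add: minus_fvec_def coord_Abs)
qed

lemma coord_scaleR [simp]: "coord (r *\<^sub>R x) i = r * coord x i"
proof -
  have "finite {i. r * coord x i \<noteq> 0}"
    by (rule finite_subset[of _ "{i. coord x i \<noteq> 0}"]) auto
  then show ?thesis by (simp add: scaleR_fvec_def coord_Abs)
qed

instance
  by standard (auto intro!: fvec_eqI simp: algebra_simps)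

end

instantiation fvec :: real_inner
begin

definition "inner x y = (\<Sum>i | coord x i \<noteq> 0. coord x i * coord y i)"
definition "norm (x :: fvec) = sqrt (inner x x)"
definition "dist (x :: fvec) y = norm (x - y)"
definition "sgn (x :: fvec) = x /\<^sub>R norm x"
definition "(uniformity :: (fvec \<times> fvec) filter) =
  (INF e\<in>{0<..}. principal {(x, y). dist x y < e})"
definition "open (U :: fvec set) \<longleftrightarrow> (\<forall>x\<in>U. eventually (\<lambda>(x', y). x' = x \<longrightarrow> y \<in> U) uniformity)"

lemma inner_fvec_supset:
  assumes "finite S" "{i. coord x i \<noteq> 0} \<subseteq> S"
  shows "inner x y = (\<Sum>i\<in>S. coord x i * coord y i)"
  unfolding inner_fvec_def by (rule sum.mono_neutral_left) (use assms in auto)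

instance
proof
  fix x y z :: fvec and r :: real
  let ?S = "{i. coord x i \<noteq> 0} \<union> {i. coord y i \<noteq> 0}"
  have x: "inner x u = (\<Sum>i\<in>?S. coord x i * coord u i)" for u
    by (rule inner_fvec_supset) auto
  have y: "inner y u = (\<Sum>i\<in>?S. coord y i * coord u i)" for u
    by (rule inner_fvec_supset) auto
  have xy: "inner (x + y) u = (\<Sum>i\<in>?S. coord (x + y) i * coord u i)" for u
    by (rule inner_fvec_supset) auto
  have rx: "inner (r *\<^sub>R x) u = (\<Sum>i\<in>?S. coord (r *\<^sub>R x) i * coord u i)" for u
    by (rule inner_fvec_supset) auto
  show "inner x y = inner y x" by (simp add: x y mult.commute)
  show "inner (x + y) z = inner x z + inner y z"
    by (simp add: x y xy distrib_right sum.distrib)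
  show "inner (r *\<^sub>R x) y = r * inner x y"
    by (simp add: x rx sum_distrib_left mult.assoc)
  show "0 \<le> inner x x" by (simp add: inner_fvec_def sum_nonneg)
  show "inner x x = 0 \<longleftrightarrow> x = 0"
  proof
    assume "inner x x = 0"
    then have "\<forall>i\<in>{i. coord x i \<noteq> 0}. coord x i * coord x i = 0"
      unfolding inner_fvec_def by (subst (asm) sum_nonneg_eq_0_iff) auto
    then show "x = 0" by (intro fvec_eqI) auto
  qed (simp add: inner_fvec_def)
qed (simp_all add: norm_fvec_def dist_fvec_def sgn_fvec_def uniformity_fvec_def open_fvec_def)

end

definition Rn :: "nat \<Rightarrow> fvec set" where
  "Rn n = {x. \<forall>i\<ge>n. coord x i = 0}"

lemma inner_Rn: "x \<in> Rn n \<Longrightarrow> x \<bullet> y = (\<Sum>i<n. coord x i * coord y i)"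
  by (rule inner_fvec_supset) (auto simp: Rn_def not_less[symmetric])


section \<open>Convex functions on $R^n$\<close>

text \<open>
  Functions on $R^n$ are represented by functions on \<^typ>\<open>fvec\<close> whose values outside \<open>Rn n\<close> are
  irrelevant.  Differentiability is relative to the subspace, and gradients lie in it.
\<close>

definition has_grad :: "nat \<Rightarrow> (fvec \<Rightarrow> real) \<Rightarrow> fvec \<Rightarrow> fvec \<Rightarrow> bool" where
  "has_grad n g x G \<longleftrightarrow> G \<in> Rn n \<and> (g has_derivative (\<lambda>d. G \<bullet> d)) (at x within Rn n)"

definition grad :: "nat \<Rightarrow> (fvec \<Rightarrow> real) \<Rightarrow> fvec \<Rightarrow> fvec" where
  "grad n g x = (THE G. has_grad n g x G)"

definition smooth :: "nat \<Rightarrow> real \<Rightarrow> (fvec \<Rightarrow> real) \<Rightarrow> bool" where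
  "smooth n L g \<longleftrightarrow> (\<forall>x\<in>Rn n. \<exists>G. has_grad n g x G) \<and> L-lipschitz_on (Rn n) (grad n g)"

definition strongly_convex :: "nat \<Rightarrow> real \<Rightarrow> (fvec \<Rightarrow> real) \<Rightarrow> bool" where
  "strongly_convex n \<mu> g \<longleftrightarrow>
     (\<forall>x\<in>Rn n. \<forall>y\<in>Rn n. \<forall>t\<in>{0..1}.
        g (t *\<^sub>R x + (1 - t) *\<^sub>R y)
          \<le> t * g x + (1 - t) * g y - \<mu> / 2 * (t * (1 - t)) * (norm (x - y))\<^sup>2)"

definition epi :: "nat \<Rightarrow> (fvec \<Rightarrow> ereal) \<Rightarrow> (fvec \<times> real) set" where
  "epi n h = {(x, r). x \<in> Rn n \<and> h x \<le> ereal r}"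

definition edom :: "nat \<Rightarrow> (fvec \<Rightarrow> ereal) \<Rightarrow> fvec set" where
  "edom n h = {x \<in> Rn n. h x < \<infinity>}"

definition proper_closed_convex :: "nat \<Rightarrow> (fvec \<Rightarrow> ereal) \<Rightarrow> bool" where
  "proper_closed_convex n h \<longleftrightarrow>
     (\<forall>x\<in>Rn n. h x \<noteq> -\<infinity>) \<and> edom n h \<noteq> {} \<and> closed (epi n h) \<and> convex (epi n h)"

text \<open>The linearization \<open>\<ell>\<^sub>g(u; x)\<close>.\<close>

definition lin :: "nat \<Rightarrow> (fvec \<Rightarrow> real) \<Rightarrow> fvec \<Rightarrow> fvec \<Rightarrow> real" where
  "lin n g u x = g x + grad n g x \<bullet> (u - x)"


section \<open>The composite problem\<close>

definition objective :: "(fvec \<Rightarrow> real) \<Rightarrow> (fvec \<Rightarrow> ereal) \<Rightarrow> fvec \<Rightarrow> ereal" where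
  "objective f h u = ereal (f u) + h u"

definition minimizers :: "nat \<Rightarrow> (fvec \<Rightarrow> real) \<Rightarrow> (fvec \<Rightarrow> ereal) \<Rightarrow> fvec set" where
  "minimizers n f h = {x. is_arg_min (objective f h) (\<lambda>u. u \<in> Rn n) x}"

text \<open>
  A smooth function on $R^n$ is finite everywhere, so \<open>f\<close> is real-valued; it is then automatically
  proper and closed, and its domain contains that of \<open>h\<close>.
\<close>

definition composite_problem ::
    "nat \<Rightarrow> (fvec \<Rightarrow> real) \<Rightarrow> (fvec \<Rightarrow> ereal) \<Rightarrow> real \<Rightarrow> real \<Rightarrow> bool" where
  "composite_problem n f h \<mu>f Lf \<longleftrightarrow>
     0 < Lf \<and> 0 \<le> 2 * \<mu>f \<and> 2 * \<mu>f \<le> Lf \<and>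
     strongly_convex n \<mu>f f \<and> smooth n Lf f \<and>
     proper_closed_convex n h \<and> minimizers n f h \<noteq> {}"

definition eps_solution ::
    "nat \<Rightarrow> (fvec \<Rightarrow> real) \<Rightarrow> (fvec \<Rightarrow> ereal) \<Rightarrow> real \<Rightarrow> fvec \<Rightarrow> bool" where
  "eps_solution n f h \<epsilon> u \<longleftrightarrow>
     u \<in> Rn n \<and> objective f h u - (INF x\<in>Rn n. objective f h x) \<le> ereal \<epsilon>"

text \<open>The minimum defining \<open>R0\<close> is attained, hence equals the infimum used here.\<close>

definition R0 :: "nat \<Rightarrow> (fvec \<Rightarrow> real) \<Rightarrow> (fvec \<Rightarrow> ereal) \<Rightarrow> fvec \<Rightarrow> real" where
  "R0 n f h w0 = (INF x\<in>minimizers n f h. norm (w0 - x))"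


section \<open>ACG\<close>

definition acg_step :: "real \<Rightarrow> real \<Rightarrow> real \<Rightarrow> real" where
  "acg_step L A \<tau> = (\<tau> + sqrt (\<tau>\<^sup>2 + 8 * \<tau> * A * L)) / (4 * L)"

fun acg_A :: "real \<Rightarrow> real \<Rightarrow> nat \<Rightarrow> real" and acg_tau :: "real \<Rightarrow> real \<Rightarrow> nat \<Rightarrow> real" where
  "acg_A \<mu> L 0 = 0"
| "acg_A \<mu> L (Suc j) = acg_A \<mu> L j + acg_step L (acg_A \<mu> L j) (acg_tau \<mu> L j)"
| "acg_tau \<mu> L 0 = 1"
| "acg_tau \<mu> L (Suc j) = acg_tau \<mu> L j + \<mu> * acg_step L (acg_A \<mu> L j) (acg_tau \<mu> L j)"

definition acg_a :: "real \<Rightarrow> real \<Rightarrow> nat \<Rightarrow> real" where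
  "acg_a \<mu> L j = acg_step L (acg_A \<mu> L j) (acg_tau \<mu> L j)"

text \<open>
  An ACG execution is given by the sequences \<open>x\<close>, \<open>y\<close> and \<open>yt\<close>, where \<open>yt (Suc j)\<close> is the point
  computed by iteration \<open>j\<close> (\<open>yt 0\<close> is unused).
\<close>

definition acg_xt :: "real \<Rightarrow> real \<Rightarrow> (nat \<Rightarrow> fvec) \<Rightarrow> (nat \<Rightarrow> fvec) \<Rightarrow> nat \<Rightarrow> fvec" where
  "acg_xt \<mu> L x y j =
     (acg_A \<mu> L j / acg_A \<mu> L (Suc j)) *\<^sub>R y j + (acg_a \<mu> L j / acg_A \<mu> L (Suc j)) *\<^sub>R x j"

definition acg_Gamma ::
    "nat \<Rightarrow> (fvec \<Rightarrow> real) \<Rightarrow> (fvec \<Rightarrow> ereal) \<Rightarrow> real \<Rightarrow> real \<Rightarrow> fvec \<Rightarrow> fvec \<Rightarrow> ereal" where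
  "acg_Gamma n g h \<mu> L z u =
     ereal (lin n g u z) + h u + ereal ((2 * L + \<mu>) / 2 * (norm (u - z))\<^sup>2)"

text \<open>
  Since \<open>y_{j+1}\<close> and \<open>w_{k+1}\<close> may be chosen arbitrarily in case of ties, an execution is described
  by a predicate.  Extended-real values matter: the starting point handed to ACG by the restarted
  method need not belong to the domain of \<open>h\<close>, in which case \<open>y\<^sub>1\<close> is necessarily \<open>yt 1\<close>.
\<close>

definition acg_run ::
    "nat \<Rightarrow> (fvec \<Rightarrow> real) \<Rightarrow> (fvec \<Rightarrow> ereal) \<Rightarrow> real \<Rightarrow> real \<Rightarrow> fvec
      \<Rightarrow> (nat \<Rightarrow> fvec) \<Rightarrow> (nat \<Rightarrow> fvec) \<Rightarrow> (nat \<Rightarrow> fvec) \<Rightarrow> bool" where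
  "acg_run n g h \<mu> L x0 x y yt \<longleftrightarrow>
     x 0 = x0 \<and> y 0 = x0 \<and>
     (\<forall>j. is_arg_min (acg_Gamma n g h \<mu> L (acg_xt \<mu> L x y j)) (\<lambda>u. u \<in> Rn n) (yt (Suc j)) \<and>
          is_arg_min (objective g h) (\<lambda>u. u \<in> {y j, yt (Suc j)}) (y (Suc j)) \<and>
          x (Suc j) =
            (1 / (acg_A \<mu> L (Suc j) * \<mu> + 1)) *\<^sub>R
              (((2 * L + \<mu>) * acg_a \<mu> L j) *\<^sub>R yt (Suc j)
                - (2 * acg_A \<mu> L j * acg_a \<mu> L j * L / acg_A \<mu> L (Suc j)) *\<^sub>R y j))"

text \<open>
  \<open>acg_theta z yn\<close> is \<open>\<theta>\<^sub>j\<^sub>+\<^sub>1\<close> for \<open>z = \<tilde>x\<^sub>j\<close> and \<open>yn = \<tilde>y\<^sub>j\<^sub>+\<^sub>1\<close>, and \<open>(2 * L) *\<^sub>R (z - yn)\<close> is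
  \<open>u\<^sub>j\<^sub>+\<^sub>1\<close>.  The value of \<open>\<Gamma>\<^sub>j\<close> at its minimizer \<open>yn\<close> is finite because \<open>h\<close> is proper.
\<close>

definition acg_theta ::
    "nat \<Rightarrow> (fvec \<Rightarrow> real) \<Rightarrow> (fvec \<Rightarrow> ereal) \<Rightarrow> real \<Rightarrow> real
      \<Rightarrow> fvec \<Rightarrow> fvec \<Rightarrow> fvec \<Rightarrow> real" where
  "acg_theta n g h \<mu> L z yn u =
     real_of_ereal (acg_Gamma n g h \<mu> L z yn) - L * (norm (yn - z))\<^sup>2
       + ((2 * L) *\<^sub>R (z - yn)) \<bullet> (u - yn) + \<mu> / 2 * (norm (u - yn))\<^sup>2"

fun acg_Theta ::
    "nat \<Rightarrow> (fvec \<Rightarrow> real) \<Rightarrow> (fvec \<Rightarrow> ereal) \<Rightarrow> real \<Rightarrow> real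
      \<Rightarrow> (nat \<Rightarrow> fvec) \<Rightarrow> (nat \<Rightarrow> fvec) \<Rightarrow> (nat \<Rightarrow> fvec) \<Rightarrow> nat \<Rightarrow> fvec \<Rightarrow> real" where
  "acg_Theta n g h \<mu> L x y yt 0 u = 0"
| "acg_Theta n g h \<mu> L x y yt (Suc j) u =
     (acg_A \<mu> L j * acg_Theta n g h \<mu> L x y yt j u
       + acg_a \<mu> L j * acg_theta n g h \<mu> L (acg_xt \<mu> L x y j) (yt (Suc j)) u)
     / acg_A \<mu> L (Suc j)"

definition acg_s :: "real \<Rightarrow> real \<Rightarrow> fvec \<Rightarrow> (nat \<Rightarrow> fvec) \<Rightarrow> nat \<Rightarrow> fvec" where
  "acg_s \<mu> L x0 x j = (1 / acg_A \<mu> L j) *\<^sub>R (x0 - x j)"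


section \<open>Restarted ACG\<close>

definition racg_step :: "real \<Rightarrow> real \<Rightarrow> real \<Rightarrow> real" where
  "racg_step lam B \<tau> = (\<tau> * lam + sqrt (\<tau>\<^sup>2 * lam\<^sup>2 + 4 * \<tau> * lam * B)) / 2"

fun racg_B :: "real \<Rightarrow> real \<Rightarrow> nat \<Rightarrow> real" and racg_tau :: "real \<Rightarrow> real \<Rightarrow> nat \<Rightarrow> real" where
  "racg_B \<mu>f lam 0 = 0"
| "racg_B \<mu>f lam (Suc k) =
     racg_B \<mu>f lam k + racg_step lam (racg_B \<mu>f lam k) (racg_tau \<mu>f lam k)"
| "racg_tau \<mu>f lam 0 = 1"
| "racg_tau \<mu>f lam (Suc k) =
     racg_tau \<mu>f lam k + racg_step lam (racg_B \<mu>f lam k) (racg_tau \<mu>f lam k) * \<mu>f"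

definition racg_b :: "real \<Rightarrow> real \<Rightarrow> nat \<Rightarrow> real" where
  "racg_b \<mu>f lam k = racg_step lam (racg_B \<mu>f lam k) (racg_tau \<mu>f lam k)"

definition racg_vt :: "real \<Rightarrow> real \<Rightarrow> (nat \<Rightarrow> fvec) \<Rightarrow> (nat \<Rightarrow> fvec) \<Rightarrow> nat \<Rightarrow> fvec" where
  "racg_vt \<mu>f lam w v k =
     (racg_B \<mu>f lam k / racg_B \<mu>f lam (Suc k)) *\<^sub>R w k
       + (racg_b \<mu>f lam k / racg_B \<mu>f lam (Suc k)) *\<^sub>R v k"

definition racg_g :: "(fvec \<Rightarrow> real) \<Rightarrow> real \<Rightarrow> fvec \<Rightarrow> fvec \<Rightarrow> real" where
  "racg_g f lam c u = f u + 1 / (2 * lam) * (norm (u - c))\<^sup>2"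

definition racg_stop ::
    "nat \<Rightarrow> (fvec \<Rightarrow> real) \<Rightarrow> (fvec \<Rightarrow> ereal) \<Rightarrow> real \<Rightarrow> real \<Rightarrow> real \<Rightarrow> real
      \<Rightarrow> fvec \<Rightarrow> (nat \<Rightarrow> fvec) \<Rightarrow> (nat \<Rightarrow> fvec) \<Rightarrow> (nat \<Rightarrow> fvec) \<Rightarrow> nat \<Rightarrow> bool" where
  "racg_stop n g h \<mu> L \<sigma> lam x0 x y yt j \<longleftrightarrow> 1 \<le> j \<and>
     ereal ((norm (lam *\<^sub>R acg_s \<mu> L x0 x j))\<^sup>2)
       + ereal (2 * lam) * (objective g h (y j) - ereal (acg_Theta n g h \<mu> L x y yt j (x j)))
     \<le> ereal (\<sigma> * (norm (y j - x0))\<^sup>2)"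

text \<open>
  The \<open>k\<close>-th inner call is the ACG execution \<open>x k\<close>, \<open>y k\<close>, \<open>yt k\<close>.  It is regarded as an infinite
  execution, of which only the iterations up to the first one satisfying the stopping test are
  counted and used.  That such an iteration exists is not assumed here; it is part of
  \<open>racg_finds\<close> below.
\<close>

definition racg_stops_at ::
    "nat \<Rightarrow> (fvec \<Rightarrow> real) \<Rightarrow> (fvec \<Rightarrow> ereal) \<Rightarrow> real \<Rightarrow> real \<Rightarrow> real \<Rightarrow> real
      \<Rightarrow> (nat \<Rightarrow> fvec) \<Rightarrow> (nat \<Rightarrow> fvec)
      \<Rightarrow> (nat \<Rightarrow> nat \<Rightarrow> fvec) \<Rightarrow> (nat \<Rightarrow> nat \<Rightarrow> fvec) \<Rightarrow> (nat \<Rightarrow> nat \<Rightarrow> fvec)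
      \<Rightarrow> nat \<Rightarrow> nat \<Rightarrow> bool" where
  "racg_stops_at n f h \<mu>f Lf \<sigma> lam w v x y yt k j \<longleftrightarrow>
     racg_stop n (racg_g f lam (racg_vt \<mu>f lam w v k)) h (\<mu>f + 1 / lam) (Lf - \<mu>f) \<sigma> lam
       (racg_vt \<mu>f lam w v k) (x k) (y k) (yt k) j"

definition racg_inner_iterations where
  "racg_inner_iterations n f h \<mu>f Lf \<sigma> lam w v x y yt k =
     (LEAST j. racg_stops_at n f h \<mu>f Lf \<sigma> lam w v x y yt k j)"

definition racg_run ::
    "nat \<Rightarrow> (fvec \<Rightarrow> real) \<Rightarrow> (fvec \<Rightarrow> ereal) \<Rightarrow> real \<Rightarrow> real \<Rightarrow> real \<Rightarrow> real \<Rightarrow> fvec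
      \<Rightarrow> (nat \<Rightarrow> fvec) \<Rightarrow> (nat \<Rightarrow> fvec)
      \<Rightarrow> (nat \<Rightarrow> nat \<Rightarrow> fvec) \<Rightarrow> (nat \<Rightarrow> nat \<Rightarrow> fvec) \<Rightarrow> (nat \<Rightarrow> nat \<Rightarrow> fvec) \<Rightarrow> bool" where
  "racg_run n f h \<mu>f Lf \<sigma> lam w0 w v x y yt \<longleftrightarrow>
     w 0 = w0 \<and> v 0 = w0 \<and>
     (\<forall>k. let vt = racg_vt \<mu>f lam w v k;
              \<mu> = \<mu>f + 1 / lam;
              L = Lf - \<mu>f;
              j = racg_inner_iterations n f h \<mu>f Lf \<sigma> lam w v x y yt k
          in acg_run n (racg_g f lam vt) h \<mu> L vt (x k) (y k) (yt k) \<and>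
             is_arg_min (objective f h) (\<lambda>u. u \<in> {w k, y k j}) (w (Suc k)) \<and>
             v (Suc k) =
               (1 / racg_tau \<mu>f lam (Suc k)) *\<^sub>R
                 (racg_tau \<mu>f lam k *\<^sub>R v k
                   + (racg_b \<mu>f lam k * \<mu>f) *\<^sub>R x k j
                   - (racg_b \<mu>f lam k * ((acg_A \<mu> L j + lam) / lam)) *\<^sub>R acg_s \<mu> L vt (x k) j))"

text \<open>
  \<open>racg_finds \<dots> N\<close>: some iterate is an \<open>\<epsilon>\<close>-solution, every inner call preceding the first such
  iterate \<open>w K\<close> terminates, and these calls take at most \<open>N\<close> ACG iterations in total.
\<close>

definition racg_finds ::
    "nat \<Rightarrow> (fvec \<Rightarrow> real) \<Rightarrow> (fvec \<Rightarrow> ereal) \<Rightarrow> real \<Rightarrow> real \<Rightarrow> real \<Rightarrow> real \<Rightarrow> real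
      \<Rightarrow> (nat \<Rightarrow> fvec) \<Rightarrow> (nat \<Rightarrow> fvec)
      \<Rightarrow> (nat \<Rightarrow> nat \<Rightarrow> fvec) \<Rightarrow> (nat \<Rightarrow> nat \<Rightarrow> fvec) \<Rightarrow> (nat \<Rightarrow> nat \<Rightarrow> fvec)
      \<Rightarrow> real \<Rightarrow> bool" where
  "racg_finds n f h \<mu>f Lf \<sigma> lam \<epsilon> w v x y yt N \<longleftrightarrow>
     (\<exists>K. eps_solution n f h \<epsilon> (w K) \<and>
          (\<forall>k<K. \<not> eps_solution n f h \<epsilon> (w k)) \<and>
          (\<forall>k<K. \<exists>j. racg_stops_at n f h \<mu>f Lf \<sigma> lam w v x y yt k j) \<and>
          real (\<Sum>k<K. racg_inner_iterations n f h \<mu>f Lf \<sigma> lam w v x y yt k) \<le> N)"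

text \<open>
  The logarithmic factors hidden by the soft-O notation are powers of this quantity.
  For \<open>\<mu>f = 0\<close> the corresponding term vanishes, since \<open>ln 0 = 0\<close>.
\<close>

definition log_factor :: "real \<Rightarrow> real \<Rightarrow> real \<Rightarrow> real \<Rightarrow> real \<Rightarrow> real" where
  "log_factor \<mu>f Lf lam R \<epsilon> = 1 + \<bar>ln \<mu>f\<bar> + \<bar>ln Lf\<bar> + \<bar>ln lam\<bar> + \<bar>ln R\<bar> + \<bar>ln \<epsilon>\<bar>"

end

(*
  Both loops are instances of one estimate-sequence argument.  In the inner loop A_j * Theta_j
  plus half the squared distance to x_0 is a quadratic with minimizer x_j and minimum at least
  A_j * psi(y_j).  This bounds the left-hand side of the stopping test by a multiple of
  lam^2 / A_j^2 + lam / A_j, so the test holds as soon as A_j >= 8 lam / sigma, and since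
  A_j >= j^2 / (8 L) this happens after O(sqrt (L lam / sigma)) iterations.  Conversely, the test
  makes the model Theta_j minus the proximal term good enough for the outer estimate sequence,
  which gives phi(w_k) - phi_* <= R_0^2 / (2 B_k).  Finally B_k >= lam k^2 / 4 always, and
  B_(k+1) >= lam (1 + sqrt (mu_f lam))^k; multiplying the numbers of outer and inner iterations
  cancels lam.  A logarithm appears only through the geometric bound on B_k.
*)
theory Submission
  imports Defs
begin

section \<open>Quadratic bounds for smooth, strongly convex functions\<close>

text \<open>The point handed to an inner call can lie outside the domain of \<open>h\<close>, where
  \<open>real_of_ereal\<close> returns a default value. The inner estimates are therefore multiplied
  by \<open>A j\<close>, which is 0 at index 0; from index 1 on the points \<open>y j\<close> lie in
  the domain. The stopping test serves the outer loop because psi contains the proximal term: 2 lam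
  psi(y_j) includes the whole squared distance from y_j to x_0, which absorbs the right-hand side
  since sigma < 1. What remains says that phi(y_j) is at most the minimum of Theta_j, because the
  curvature of Theta_j is at least 1 / lam. The bounds on lam keep rounding harmless: lam >= 1 / L
  makes the scale sqrt (L lam / sigma) of an inner call at least 1, and lam <= R_0^2 / eps does the
  same for the scale R_0 / sqrt (lam eps) of the number of restarts. The bound lam <= 1 / mu_f keeps
  the rate sqrt (mu_f lam) in (0, 1], where ln (1 + s) and s are comparable.\<close>

lemma subspace_Rn: "subspace (Rn n)"
  by (auto simp: subspace_def Rn_def)

lemmas Rn_intros = subspace_add[OF subspace_Rn] subspace_diff[OF subspace_Rn]
  subspace_scale[OF subspace_Rn] subspace_0[OF subspace_Rn]

text \<open>The line stays in \<open>Rn n\<close>, so the derivative relative to the subspace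
  restricts to an ordinary derivative in one real variable.\<close>

lemma has_grad_line_deriv:
  assumes "has_grad n g (z + t *\<^sub>R d) G" "z \<in> Rn n" "d \<in> Rn n"
  shows "((\<lambda>t. g (z + t *\<^sub>R d)) has_real_derivative G \<bullet> d) (at t)"
proof -
  have g: "(g has_derivative (\<lambda>d. G \<bullet> d)) (at (z + t *\<^sub>R d) within Rn n)"
    using assms(1) by (simp add: has_grad_def)
  have "((\<lambda>t. z + t *\<^sub>R d) has_derivative (\<lambda>s. s *\<^sub>R d)) (at t)"
    by (auto intro!: derivative_eq_intros)
  moreover have "(g has_derivative (\<lambda>d. G \<bullet> d)) (at (z + t *\<^sub>R d) within range (\<lambda>t. z + t *\<^sub>R d))"
    by (rule has_derivative_subset[OF g]) (use assms in \<open>auto intro!: Rn_intros\<close>)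
  ultimately have "((\<lambda>t. g (z + t *\<^sub>R d)) has_derivative (\<lambda>s. G \<bullet> (s *\<^sub>R d))) (at t)"
    by (rule has_derivative_in_compose)
  then show ?thesis
    by (simp add: has_field_derivative_def mult_commute_abs)
qed

text \<open>Gradients lie in \<open>Rn n\<close> by definition, so \<open>G - G'\<close> is an
  admissible direction; the derivatives along it agree, which forces it to be 0.\<close>

lemma has_grad_unique:
  assumes "has_grad n g z G" "has_grad n g z G'" "z \<in> Rn n"
  shows "G = G'"
proof -
  let ?d = "G - G'"
  have d: "?d \<in> Rn n"
    using assms by (auto simp: has_grad_def intro!: Rn_intros)
  have "G \<bullet> ?d = G' \<bullet> ?d"
    using has_grad_line_deriv[of n g z 0 ?d G] has_grad_line_deriv[of n g z 0 ?d G'] assms d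
    by (auto intro: DERIV_unique)
  then have "?d \<bullet> ?d = 0"
    by (simp add: inner_diff_left)
  then show ?thesis by simp
qed

lemma grad_eqI: "has_grad n g z G \<Longrightarrow> z \<in> Rn n \<Longrightarrow> grad n g z = G"
  unfolding grad_def by (rule the_equality) (auto intro: has_grad_unique)

lemma smooth_has_grad:
  assumes "smooth n L g" "z \<in> Rn n"
  shows "has_grad n g z (grad n g z)"
  using assms grad_eqI unfolding smooth_def by metis

lemma strongly_convex_lower:
  assumes sc: "strongly_convex n \<mu> g" and G: "has_grad n g z (grad n g z)"
    and u: "u \<in> Rn n" and z: "z \<in> Rn n"
  shows "lin n g u z + \<mu> / 2 * (norm (u - z))\<^sup>2 \<le> g u"
proof (rule ccontr)
  let ?d = "u - z"
  \<comment> \<open>\<open>p\<close> is the slack of the strong convexity inequality along the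
    segment: it is 0 at 0 and nonnegative on [0, 1], so its slope at 0 cannot be negative.\<close>
  define p where "p t = g z + t * (g u - g z) - \<mu> / 2 * (t * (1 - t)) * (norm ?d)\<^sup>2
    - g (z + t *\<^sub>R ?d)" for t
  assume "\<not> ?thesis"
  then have neg: "g u - g z - \<mu> / 2 * (norm ?d)\<^sup>2 - grad n g z \<bullet> ?d < 0"
    by (simp add: lin_def)
  have "((\<lambda>t. g (z + t *\<^sub>R ?d)) has_real_derivative grad n g z \<bullet> ?d) (at 0)"
    by (rule has_grad_line_deriv) (use u z G in \<open>auto intro!: Rn_intros\<close>)
  then have "(p has_real_derivative g u - g z - \<mu> / 2 * (norm ?d)\<^sup>2 - grad n g z \<bullet> ?d) (at 0)"
    unfolding p_def by (auto intro!: derivative_eq_intros)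
  from DERIV_neg_dec_right[OF this neg] obtain e where
    e: "e > 0" "\<And>s. 0 < s \<Longrightarrow> s < e \<Longrightarrow> p s < p 0"
    by auto
  define t where "t = min (e / 2) 1"
  have t: "0 < t" "t < e" "t \<le> 1"
    using e(1) by (auto simp: t_def)
  have "g (t *\<^sub>R u + (1 - t) *\<^sub>R z)
      \<le> t * g u + (1 - t) * g z - \<mu> / 2 * (t * (1 - t)) * (norm ?d)\<^sup>2"
    using sc u z t unfolding strongly_convex_def by auto
  moreover have "t *\<^sub>R u + (1 - t) *\<^sub>R z = z + t *\<^sub>R ?d"
    by (simp add: algebra_simps)
  ultimately have "0 \<le> p t"
    by (simp add: p_def algebra_simps)
  with e(2)[OF t(1,2)] show False
    by (simp add: p_def)
qed

lemma smooth_upper: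
  assumes sm: "smooth n L g" and u: "u \<in> Rn n" and z: "z \<in> Rn n"
  shows "g u \<le> lin n g u z + L / 2 * (norm (u - z))\<^sup>2"
proof -
  let ?d = "u - z"
  have d: "?d \<in> Rn n" using u z by (intro Rn_intros)
  \<comment> \<open>The claim is \<open>p 1 \<le> p 0\<close>; the Lipschitz bound on the gradient
    makes the derivative of \<open>p\<close> nonpositive.\<close>
  define p where "p t = g (z + t *\<^sub>R ?d) - t * (grad n g z \<bullet> ?d) - L / 2 * t\<^sup>2 * (norm ?d)\<^sup>2" for t
  have "p 1 \<le> p 0"
  proof (rule DERIV_nonpos_imp_nonincreasing[of 0 1 p])
    fix t :: real assume t: "0 \<le> t" "t \<le> 1"
    let ?G = "grad n g (z + t *\<^sub>R ?d)"
    have zt: "z + t *\<^sub>R ?d \<in> Rn n" by (rule subspace_add[OF subspace_Rn z subspace_scale[OF subspace_Rn d]])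
    have "((\<lambda>t. g (z + t *\<^sub>R ?d)) has_real_derivative ?G \<bullet> ?d) (at t)"
      by (rule has_grad_line_deriv[OF smooth_has_grad[OF sm zt] z d])
    then have "(p has_real_derivative ?G \<bullet> ?d - grad n g z \<bullet> ?d - L * t * (norm ?d)\<^sup>2) (at t)"
      unfolding p_def by (auto intro!: derivative_eq_intros)
    moreover have "?G \<bullet> ?d - grad n g z \<bullet> ?d \<le> L * t * (norm ?d)\<^sup>2"
    proof -
      have "dist ?G (grad n g z) \<le> L * dist (z + t *\<^sub>R ?d) z"
        using sm zt z by (auto simp: smooth_def lipschitz_on_def)
      then have "norm (?G - grad n g z) \<le> L * t * norm ?d"
        using t by (simp add: dist_norm)
      then have "norm (?G - grad n g z) * norm ?d \<le> L * t * norm ?d * norm ?d"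
        by (rule mult_right_mono) simp
      then show ?thesis
        using norm_cauchy_schwarz[of "?G - grad n g z" ?d]
        by (simp add: inner_diff_left power2_eq_square mult.assoc)
    qed
    ultimately show "\<exists>D. (p has_real_derivative D) (at t) \<and> D \<le> 0"
      by fastforce
  qed simp
  then show ?thesis
    by (simp add: p_def lin_def)
qed

section \<open>The proximal term added to \<open>f\<close>\<close>

lemma has_grad_racg_g:
  assumes "has_grad n f z G" "z \<in> Rn n" "c \<in> Rn n"
  shows "has_grad n (racg_g f lam c) z (G + (1 / lam) *\<^sub>R (z - c))"
proof -
  have f: "(f has_derivative (\<lambda>d. G \<bullet> d)) (at z within Rn n)" and G: "G \<in> Rn n"
    using assms(1) by (auto simp: has_grad_def)
  have "((\<lambda>u. u - c) has_derivative (\<lambda>d. d)) (at z within Rn n)"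
    by (auto intro!: derivative_eq_intros)
  from has_derivative_add[OF f has_derivative_mult_right[OF has_derivative_inner[OF this this]],
      of "1 / (2 * lam)"]
  have "((\<lambda>u. f u + 1 / (2 * lam) * ((u - c) \<bullet> (u - c))) has_derivative
      (\<lambda>d. G \<bullet> d + 1 / (2 * lam) * ((z - c) \<bullet> d + d \<bullet> (z - c)))) (at z within Rn n)" .
  moreover have "(\<lambda>d. G \<bullet> d + 1 / (2 * lam) * ((z - c) \<bullet> d + d \<bullet> (z - c)))
      = (\<lambda>d. (G + (1 / lam) *\<^sub>R (z - c)) \<bullet> d)"
  proof
    fix d
    have "1 / (2 * lam) * ((z - c) \<bullet> d + d \<bullet> (z - c)) = 1 / lam * ((z - c) \<bullet> d)"
      by (simp add: inner_commute[of d])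
    then show "G \<bullet> d + 1 / (2 * lam) * ((z - c) \<bullet> d + d \<bullet> (z - c))
        = (G + (1 / lam) *\<^sub>R (z - c)) \<bullet> d"
      by (simp only: inner_add_left inner_scaleR_left)
  qed
  moreover have "G + (1 / lam) *\<^sub>R (z - c) \<in> Rn n"
    using G assms by (intro Rn_intros)
  ultimately show ?thesis
    by (simp add: has_grad_def racg_g_def[abs_def] power2_norm_eq_inner)
qed

text \<open>The proximal term is quadratic, so its linearization error is exactly
  \<open>1 / (2 * lam) * (norm (u - z))^2\<close>; both curvature bounds of \<open>f\<close>
  therefore shift by \<open>1 / lam\<close>.\<close>

lemma lin_racg_g:
  assumes "has_grad n f z (grad n f z)" "z \<in> Rn n" "c \<in> Rn n" "lam \<noteq> 0"
  shows "lin n (racg_g f lam c) u z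
    = lin n f u z + 1 / (2 * lam) * ((norm (u - c))\<^sup>2 - (norm (u - z))\<^sup>2)"
proof -
  have "(norm (u - c))\<^sup>2 - (norm (u - z))\<^sup>2 = (norm (z - c))\<^sup>2 + 2 * ((z - c) \<bullet> (u - z))"
    by (simp add: power2_norm_eq_inner inner_diff_left inner_diff_right inner_commute)
  then have "1 / (2 * lam) * ((norm (u - c))\<^sup>2 - (norm (u - z))\<^sup>2)
      = 1 / (2 * lam) * (norm (z - c))\<^sup>2 + 1 / lam * ((z - c) \<bullet> (u - z))"
    using assms(4) by (simp add: field_simps)
  then show ?thesis
    unfolding lin_def grad_eqI[OF has_grad_racg_g[OF assms(1-3)] assms(2)] racg_g_def
    by (simp only: inner_add_left inner_scaleR_left)
qed

section \<open>Estimate sequences\<close>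

text \<open>The second assumption says that the gradient of the combined quadratic vanishes at
  \<open>v'\<close>, and \<open>m\<close> is its value there.\<close>

lemma quadratic_merge:
  fixes v v' p U :: "'a :: real_inner" and \<tau> \<tau>' b \<mu> :: real
  assumes "\<tau>' = \<tau> + b * \<mu>" "\<tau>' *\<^sub>R v' = \<tau> *\<^sub>R v + (b * \<mu>) *\<^sub>R p - b *\<^sub>R U"
  obtains m where "\<And>u. \<tau> / 2 * (norm (u - v))\<^sup>2 + b * (U \<bullet> (u - p) + \<mu> / 2 * (norm (u - p))\<^sup>2)
    = m + \<tau>' / 2 * (norm (u - v'))\<^sup>2"
proof -
  have lin: "\<tau>' * (u \<bullet> v') = \<tau> * (u \<bullet> v) + b * \<mu> * (u \<bullet> p) - b * (U \<bullet> u)" for u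
    using arg_cong[OF assms(2), of "inner u"]
    by (simp add: inner_add_right inner_diff_right inner_commute)
  have sq: "(norm (u - x))\<^sup>2 = u \<bullet> u - 2 * (u \<bullet> x) + x \<bullet> x" for u x :: 'a
    by (simp add: power2_norm_eq_inner inner_diff_left inner_diff_right inner_commute)
  show ?thesis
  proof (rule that)
    fix u
    show "\<tau> / 2 * (norm (u - v))\<^sup>2 + b * (U \<bullet> (u - p) + \<mu> / 2 * (norm (u - p))\<^sup>2)
      = \<tau> / 2 * (v \<bullet> v) - b * (U \<bullet> p) + b * \<mu> / 2 * (p \<bullet> p) - \<tau>' / 2 * (v' \<bullet> v')
        + \<tau>' / 2 * (norm (u - v'))\<^sup>2"
      using lin[of u] unfolding sq inner_diff_right assms(1) by argo
  qed
qed

lemma norm_sq_expand: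
  fixes u v p :: "'a :: real_inner"
  shows "(norm (u - p))\<^sup>2 = (norm (u - v))\<^sup>2 + 2 * ((u - v) \<bullet> (v - p)) + (norm (v - p))\<^sup>2"
  by (simp add: power2_norm_eq_inner inner_diff_left inner_diff_right inner_commute)

lemma norm_sq_convex_comb:
  fixes u v p :: "'a :: real_inner"
  assumes "s + t = 1"
  shows "(norm (s *\<^sub>R u + t *\<^sub>R v - p))\<^sup>2
    = s * (norm (u - p))\<^sup>2 + t * (norm (v - p))\<^sup>2 - s * t * (norm (u - v))\<^sup>2"
proof -
  let ?a = "u - p" and ?b = "v - p"
  have s: "s = 1 - t" using assms by simp
  have eq: "s *\<^sub>R u + t *\<^sub>R v - p = s *\<^sub>R ?a + t *\<^sub>R ?b" "u - v = ?a - ?b"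
    unfolding s by (simp_all add: algebra_simps)
  show ?thesis
    unfolding eq unfolding power2_norm_eq_inner s inner_diff_left[of ?a] inner_diff_right[of _ ?a]
      inner_add_left inner_add_right inner_scaleR_left inner_scaleR_right inner_commute[of ?b ?a]
    by algebra
qed

lemma quadratic_convex:
  fixes p U :: "'a :: real_inner" and \<mu> c :: real
  assumes "0 \<le> \<mu>" "0 \<le> s" "0 \<le> t" "s + t = 1"
  defines "q \<equiv> \<lambda>u. c + U \<bullet> (u - p) + \<mu> / 2 * (norm (u - p))\<^sup>2"
  shows "q (s *\<^sub>R u + t *\<^sub>R v) \<le> s * q u + t * q v"
proof -
  have s: "s = 1 - t" using assms by simp
  have "0 \<le> s * t * (norm (u - v))\<^sup>2" using assms by simp
  then have "(norm (s *\<^sub>R u + t *\<^sub>R v - p))\<^sup>2 \<le> s * (norm (u - p))\<^sup>2 + t * (norm (v - p))\<^sup>2"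
    using norm_sq_convex_comb[OF assms(4), of u v p] by linarith
  then have "\<mu> / 2 * (norm (s *\<^sub>R u + t *\<^sub>R v - p))\<^sup>2
      \<le> \<mu> / 2 * (s * (norm (u - p))\<^sup>2 + t * (norm (v - p))\<^sup>2)"
    using assms by (intro mult_left_mono) auto
  moreover have "s *\<^sub>R u + t *\<^sub>R v - p = s *\<^sub>R (u - p) + t *\<^sub>R (v - p)"
    unfolding s by (simp add: algebra_simps)
  then have "U \<bullet> (s *\<^sub>R u + t *\<^sub>R v - p) = s * (U \<bullet> (u - p)) + t * (U \<bullet> (v - p))"
    by (simp only: inner_add_right inner_scaleR_right)
  ultimately show ?thesis
    unfolding q_def s by argo
qed

text \<open>
  Applied with \<open>\<kappa> = 2 * L\<close> to the ACG iterations and with \<open>\<kappa> = 1 / lam\<close> to the restarts.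
\<close>

lemma estimate_step:
  fixes p U w v z u :: "'a :: real_inner" and A a \<tau> \<kappa> \<mu> c m \<beta> :: real
  defines "q \<equiv> \<lambda>u. c + U \<bullet> (u - p) + \<mu> / 2 * (norm (u - p))\<^sup>2"
  assumes A: "0 \<le> A" and a: "0 < a" and \<mu>: "0 \<le> \<mu>"
    and \<kappa>: "\<kappa> * a\<^sup>2 = \<tau> * (A + a)"
    and z: "z = (A / (A + a)) *\<^sub>R w + (a / (A + a)) *\<^sub>R v"
    and m: "A * q w \<le> m"
    and \<beta>: "\<And>\<xi>. \<beta> \<le> q \<xi> + \<kappa> / 2 * (norm (\<xi> - z))\<^sup>2"
  shows "(A + a) * \<beta> \<le> m + \<tau> / 2 * (norm (u - v))\<^sup>2 + a * q u"
proof -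
  \<comment> \<open>\<open>?\<xi>\<close> has the weights of \<open>z\<close> with \<open>u\<close>
    in place of \<open>v\<close>, so \<open>?\<xi> - z\<close> is a multiple of
    \<open>u - v\<close>, and the equation for \<open>\<kappa> * a^2\<close> turns the penalty at
    \<open>?\<xi>\<close> into the \<open>\<tau>\<close> term.\<close>
  let ?A = "A + a" and ?\<xi> = "(A / (A + a)) *\<^sub>R w + (a / (A + a)) *\<^sub>R u"
  have pos: "0 < ?A" using A a by simp
  have 0: "q ?\<xi> \<le> A / ?A * q w + a / ?A * q u"
    unfolding q_def using A a \<mu> pos
    by (intro quadratic_convex) (auto simp: add_divide_distrib[symmetric])
  have 1: "?A * q ?\<xi> \<le> A * q w + a * q u"
    using pos mult_left_mono[OF 0, of ?A] by (simp add: distrib_left)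
  have "?\<xi> - z = (a / ?A) *\<^sub>R (u - v)"
    by (simp add: z scaleR_diff_right)
  then have "(norm (?\<xi> - z))\<^sup>2 = (a / ?A)\<^sup>2 * (norm (u - v))\<^sup>2"
    by (simp add: power_mult_distrib power_divide)
  moreover have "P * (\<kappa> / 2 * ((a / P)\<^sup>2 * N)) = (\<kappa> * a\<^sup>2) / P / 2 * N" if "0 < P" for P N
    using that by (simp add: power2_eq_square field_simps)
  ultimately have "?A * (\<kappa> / 2 * (norm (?\<xi> - z))\<^sup>2) = (\<kappa> * a\<^sup>2) / ?A / 2 * (norm (u - v))\<^sup>2"
    using pos by metis
  also have "\<dots> = \<tau> / 2 * (norm (u - v))\<^sup>2"
    using pos unfolding \<kappa> by simp
  finally have 2: "?A * (\<kappa> / 2 * (norm (?\<xi> - z))\<^sup>2) = \<tau> / 2 * (norm (u - v))\<^sup>2" .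
  have "?A * \<beta> \<le> ?A * (q ?\<xi> + \<kappa> / 2 * (norm (?\<xi> - z))\<^sup>2)"
    using \<beta> pos by (intro mult_left_mono) auto
  with 1 2 m show ?thesis
    by (simp add: distrib_left)
qed

text \<open>Factor \<open>a\<close> as the difference of the squares of \<open>sqrt (A + a)\<close>
  and \<open>sqrt A\<close>, and bound their sum by \<open>2 * sqrt (A + a)\<close>. Iterated, this
  makes \<open>sqrt A\<close> grow linearly.\<close>

lemma sqrt_increment:
  fixes A a c :: real
  assumes "0 \<le> A" "0 < a" "0 \<le> c" "c * (A + a) \<le> a\<^sup>2"
  shows "sqrt A + sqrt c / 2 \<le> sqrt (A + a)"
proof -
  have "sqrt (c * (A + a)) \<le> a"
    using assms by (intro real_le_lsqrt) auto
  then have *: "sqrt c * sqrt (A + a) \<le> a"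
    by (simp add: real_sqrt_mult)
  note *
  also have "a = (sqrt (A + a) - sqrt A) * (sqrt (A + a) + sqrt A)"
    using assms by (simp add: algebra_simps)
  also have "\<dots> \<le> (sqrt (A + a) - sqrt A) * (2 * sqrt (A + a))"
    using assms by (intro mult_left_mono) auto
  finally have "(sqrt c / 2) * (2 * sqrt (A + a)) \<le> (sqrt (A + a) - sqrt A) * (2 * sqrt (A + a))"
    by simp
  then have "sqrt c / 2 \<le> sqrt (A + a) - sqrt A"
    by (rule mult_right_le_imp_le) (use assms in auto)
  then show ?thesis by simp
qed

section \<open>Proper closed convex functions\<close>

lemma edomD: "u \<in> edom n h \<Longrightarrow> u \<in> Rn n"
  by (simp add: edom_def)

lemma ereal_edom:
  assumes "proper_closed_convex n h" "u \<in> edom n h"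
  shows "h u = ereal (real_of_ereal (h u))"
  using assms by (cases "h u") (auto simp: proper_closed_convex_def edom_def)

lemma objective_edom:
  assumes "proper_closed_convex n h" "u \<in> edom n h"
  shows "objective g h u = ereal (g u + real_of_ereal (h u))"
  using ereal_edom[OF assms] unfolding objective_def by (metis plus_ereal.simps(1))

lemma edom_convex:
  assumes h: "proper_closed_convex n h" and u: "u \<in> edom n h" and v: "v \<in> edom n h"
    and t: "0 \<le> t" "t \<le> 1"
  shows "(1 - t) *\<^sub>R u + t *\<^sub>R v \<in> edom n h"
    and "real_of_ereal (h ((1 - t) *\<^sub>R u + t *\<^sub>R v))
      \<le> (1 - t) * real_of_ereal (h u) + t * real_of_ereal (h v)"
proof -
  let ?w = "(1 - t) *\<^sub>R u + t *\<^sub>R v"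
  let ?r = "(1 - t) * real_of_ereal (h u) + t * real_of_ereal (h v)"
  have "convex (epi n h)"
    using h by (simp add: proper_closed_convex_def)
  moreover have "(u, real_of_ereal (h u)) \<in> epi n h" "(v, real_of_ereal (h v)) \<in> epi n h"
    using u v ereal_edom[OF h u, symmetric] ereal_edom[OF h v, symmetric]
    by (auto simp: epi_def edom_def)
  ultimately have "(1 - t) *\<^sub>R (u, real_of_ereal (h u)) + t *\<^sub>R (v, real_of_ereal (h v)) \<in> epi n h"
    using t by (intro convexD) auto
  then have *: "?w \<in> Rn n" "h ?w \<le> ereal ?r"
    by (auto simp: epi_def)
  then show w: "?w \<in> edom n h"
    by (auto simp: edom_def)
  show "real_of_ereal (h ?w) \<le> ?r"
    using *(2) ereal_edom[OF h w] by (metis ereal_less_eq(3))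
qed

text \<open>\<open>a\<close> may have the value infinity: in the first comparison of an inner call
  it is the starting point, and if that lies outside the domain it loses against
  \<open>b\<close>.\<close>

lemma arg_min_pair:
  assumes h: "proper_closed_convex n h"
    and c: "is_arg_min (objective g h) (\<lambda>u. u \<in> {a, b}) c"
    and a: "a \<in> Rn n" and b: "b \<in> edom n h"
  shows "c \<in> edom n h"
    and "g c + real_of_ereal (h c) \<le> g b + real_of_ereal (h b)"
proof -
  have le: "objective g h c \<le> ereal (g b + real_of_ereal (h b))"
    using c by (auto simp: is_arg_min_def not_less objective_edom[OF h b, symmetric])
  have "c \<in> Rn n"
    using c a b by (auto simp: is_arg_min_def edom_def)
  moreover have "h c \<noteq> \<infinity>"
    using le by (auto simp: objective_def)
  ultimately show *: "c \<in> edom n h"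
    by (auto simp: edom_def)
  show "g c + real_of_ereal (h c) \<le> g b + real_of_ereal (h b)"
    using le objective_edom[OF h *, of g] by simp
qed

section \<open>ACG\<close>

lemma acg_Gamma_edom:
  assumes "proper_closed_convex n h" "u \<in> edom n h"
  shows "acg_Gamma n g h \<mu> L z u
    = ereal (lin n g u z + real_of_ereal (h u) + (2 * L + \<mu>) / 2 * (norm (u - z))\<^sup>2)"
  using ereal_edom[OF assms] unfolding acg_Gamma_def by (metis plus_ereal.simps(1))

text \<open>\<open>acg_Gamma\<close> is an affine function plus the convex \<open>h\<close> plus a
  quadratic of curvature \<open>2 * L + \<mu>\<close>, so it grows at that rate from its
  minimizer.\<close>

lemma acg_Gamma_growth:
  assumes h: "proper_closed_convex n h"
    and yn: "is_arg_min (acg_Gamma n g h \<mu> L z) (\<lambda>u. u \<in> Rn n) yn"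
  shows "yn \<in> edom n h"
    and "u \<in> edom n h \<Longrightarrow> real_of_ereal (acg_Gamma n g h \<mu> L z yn)
      + (2 * L + \<mu>) / 2 * (norm (u - yn))\<^sup>2 \<le> real_of_ereal (acg_Gamma n g h \<mu> L z u)"
proof -
  let ?\<Gamma> = "\<lambda>u. lin n g u z + real_of_ereal (h u) + (2 * L + \<mu>) / 2 * (norm (u - z))\<^sup>2"
  note \<Gamma> = acg_Gamma_edom[OF h]
  have min: "acg_Gamma n g h \<mu> L z yn \<le> ereal (?\<Gamma> u)" if "u \<in> edom n h" for u
    using yn edomD[OF that] \<Gamma>[OF that, of g \<mu> L z] by (metis is_arg_min_def not_less)
  obtain u0 where "u0 \<in> edom n h"
    using h by (auto simp: proper_closed_convex_def)
  from min[OF this] have "h yn \<noteq> \<infinity>"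
    by (auto simp: acg_Gamma_def)
  then show yn_dom: "yn \<in> edom n h"
    using yn by (auto simp: edom_def is_arg_min_def)
  assume u: "u \<in> edom n h"
  have "(2 * L + \<mu>) / 2 * (norm (u - yn))\<^sup>2 \<le> ?\<Gamma> u - ?\<Gamma> yn"
  \<comment> \<open>Compare \<open>yn\<close> with a point of the segment towards \<open>u\<close>,
    divide by the weight \<open>t\<close> of \<open>u\<close>, and let \<open>s = 1 - t\<close> tend
    to 1.\<close>
  proof (rule field_le_mult_one_interval)
    fix s :: real assume s: "0 < s" "s < 1"
    define t where "t = 1 - s"
    have t: "0 < t" "t < 1" "1 - t = s" "s + t = 1"
      using s by (auto simp: t_def)
    let ?w = "s *\<^sub>R yn + t *\<^sub>R u"
    have w: "?w \<in> edom n h" "real_of_ereal (h ?w) \<le> s * real_of_ereal (h yn) + t * real_of_ereal (h u)"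
      using edom_convex[OF h yn_dom u, of t] t by auto
    have "?\<Gamma> yn \<le> ?\<Gamma> ?w"
      using min[OF w(1)] unfolding \<Gamma>[OF yn_dom] by simp
    moreover have "lin n g ?w z = s * lin n g yn z + t * lin n g u z"
    proof -
      have "?w - z = s *\<^sub>R (yn - z) + t *\<^sub>R (u - z)"
        by (simp add: t_def algebra_simps)
      then show ?thesis
        by (simp add: lin_def inner_add_right t_def algebra_simps)
    qed
    ultimately have "?\<Gamma> yn \<le> s * lin n g yn z + t * lin n g u z
        + (s * real_of_ereal (h yn) + t * real_of_ereal (h u))
        + (2 * L + \<mu>) / 2 * (s * (norm (yn - z))\<^sup>2 + t * (norm (u - z))\<^sup>2 - s * t * (norm (yn - u))\<^sup>2)"
      using w(2) unfolding norm_sq_convex_comb[OF t(4)] by linarith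
    also have "\<dots> = s * ?\<Gamma> yn + t * ?\<Gamma> u - t * (s * ((2 * L + \<mu>) / 2 * (norm (yn - u))\<^sup>2))"
      by (simp only: distrib_left right_diff_distrib mult_ac)
    also have "s * ?\<Gamma> yn = ?\<Gamma> yn - t * ?\<Gamma> yn"
      unfolding t_def left_diff_distrib by simp
    finally have "t * (s * ((2 * L + \<mu>) / 2 * (norm (yn - u))\<^sup>2)) \<le> t * (?\<Gamma> u - ?\<Gamma> yn)"
      unfolding right_diff_distrib[of t "?\<Gamma> u"] by linarith
    then show "s * ((2 * L + \<mu>) / 2 * (norm (u - yn))\<^sup>2) \<le> ?\<Gamma> u - ?\<Gamma> yn"
      using t(1) by (simp add: norm_minus_commute)
  qed
  then show "real_of_ereal (acg_Gamma n g h \<mu> L z yn) + (2 * L + \<mu>) / 2 * (norm (u - yn))\<^sup>2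
      \<le> real_of_ereal (acg_Gamma n g h \<mu> L z u)"
    unfolding \<Gamma>[OF yn_dom] \<Gamma>[OF u] by simp
qed

text \<open>This form shows two things at once: adding \<open>L * (norm (u - z))^2\<close> leaves at
  least the minimum of \<open>acg_Gamma\<close>, and the growth bound puts \<open>acg_theta\<close>
  below psi.\<close>

lemma acg_theta_eq:
  "acg_theta n g h \<mu> L z yn u = real_of_ereal (acg_Gamma n g h \<mu> L z yn)
     + (2 * L + \<mu>) / 2 * (norm (u - yn))\<^sup>2 - L * (norm (u - z))\<^sup>2"
proof -
  have "((2 * L) *\<^sub>R (z - yn)) \<bullet> (u - yn) = - L * (2 * ((u - yn) \<bullet> (yn - z)))"
    by (simp add: inner_diff_left inner_diff_right inner_commute algebra_simps)
  also have "\<dots> = L * ((norm (u - yn))\<^sup>2 + (norm (yn - z))\<^sup>2 - (norm (u - z))\<^sup>2)"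
    unfolding norm_sq_expand[of u z yn] by (simp add: algebra_simps)
  finally show ?thesis
    unfolding acg_theta_def by argo
qed

section \<open>Growth of the ACG scalars\<close>

lemma acg_tau_eq: "acg_tau \<mu> L j = 1 + \<mu> * acg_A \<mu> L j"
  by (induction j) (auto simp: distrib_left)

lemma acg_step_pos:
  assumes "0 < L" "0 \<le> A" "0 < \<tau>"
  shows "0 < acg_step L A \<tau>"
  using assms by (auto simp: acg_step_def intro!: divide_pos_pos add_pos_nonneg)

text \<open>\<open>acg_step\<close> is the positive root of this quadratic equation, which is the
  assumption on \<open>\<kappa> * a^2\<close> in \<open>estimate_step\<close> for
  \<open>\<kappa> = 2 * L\<close>.\<close>

lemma acg_step_sq:
  assumes "0 < L" "0 \<le> A" "0 < \<tau>"
  shows "2 * L * (acg_step L A \<tau>)\<^sup>2 = \<tau> * (A + acg_step L A \<tau>)"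
proof -
  define r where "r = sqrt (\<tau>\<^sup>2 + 8 * \<tau> * A * L)"
  have r: "r\<^sup>2 = \<tau>\<^sup>2 + 8 * \<tau> * A * L"
    unfolding r_def using assms by simp
  have "2 * L * ((\<tau> + r) / (4 * L))\<^sup>2 = (\<tau>\<^sup>2 + 2 * \<tau> * r + r\<^sup>2) / (8 * L)"
    using assms by (simp add: power2_eq_square field_simps)
  also have "\<dots> = \<tau> * (A + (\<tau> + r) / (4 * L))"
    unfolding r using assms by (simp add: power2_eq_square field_simps)
  finally show ?thesis
    unfolding acg_step_def r_def .
qed

lemma acg_A_nonneg: "0 < L \<Longrightarrow> 0 \<le> \<mu> \<Longrightarrow> 0 \<le> acg_A \<mu> L j"
proof (induction j)
  case (Suc j)
  then show ?case
    using acg_step_pos[of L "acg_A \<mu> L j" "acg_tau \<mu> L j"] by (simp add: acg_tau_eq add_pos_nonneg)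
qed simp

lemma acg_tau_ge_1: "0 < L \<Longrightarrow> 0 \<le> \<mu> \<Longrightarrow> 1 \<le> acg_tau \<mu> L j"
  by (simp add: acg_tau_eq acg_A_nonneg)

lemma acg_a_pos: "0 < L \<Longrightarrow> 0 \<le> \<mu> \<Longrightarrow> 0 < acg_a \<mu> L j"
  unfolding acg_a_def using acg_tau_ge_1[of L \<mu> j] by (intro acg_step_pos acg_A_nonneg) auto

lemma acg_a_sq:
  "0 < L \<Longrightarrow> 0 \<le> \<mu> \<Longrightarrow>
    2 * L * (acg_a \<mu> L j)\<^sup>2 = acg_tau \<mu> L j * (acg_A \<mu> L j + acg_a \<mu> L j)"
  unfolding acg_a_def using acg_tau_ge_1[of L \<mu> j] by (intro acg_step_sq acg_A_nonneg) auto

lemma acg_A_Suc: "acg_A \<mu> L (Suc j) = acg_A \<mu> L j + acg_a \<mu> L j"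
  by (simp add: acg_a_def)

lemma acg_tau_Suc: "acg_tau \<mu> L (Suc j) = acg_tau \<mu> L j + acg_a \<mu> L j * \<mu>"
  by (simp add: acg_a_def)

lemma acg_A_pos:
  assumes "0 < L" "0 \<le> \<mu>" "1 \<le> j"
  shows "0 < acg_A \<mu> L j"
proof -
  obtain i where "j = Suc i" using assms(3) by (cases j) auto
  then show ?thesis
    using acg_a_pos[OF assms(1,2), of i] acg_A_nonneg[OF assms(1,2), of i]
    by (simp add: acg_A_Suc del: acg_A.simps)
qed

text \<open>As \<open>acg_tau\<close> is at least 1, the step equation lets
  \<open>sqrt_increment\<close> apply with \<open>c = 1 / (2 * L)\<close>; squaring the sum of the
  increments \<open>sqrt c / 2\<close> gives the 8.\<close>

lemma acg_A_lower:
  assumes "0 < L" "0 \<le> \<mu>"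
  shows "(real j)\<^sup>2 / (8 * L) \<le> acg_A \<mu> L j"
proof -
  let ?c = "1 / (2 * L)"
  have "real j * (sqrt ?c / 2) \<le> sqrt (acg_A \<mu> L j)"
  proof (induction j)
    case (Suc j)
    have "acg_A \<mu> L j + acg_a \<mu> L j \<le> 2 * L * (acg_a \<mu> L j)\<^sup>2"
      unfolding acg_a_sq[OF assms]
      using mult_right_mono[OF acg_tau_ge_1[OF assms, of j], of "acg_A \<mu> L j + acg_a \<mu> L j"]
        acg_A_nonneg[OF assms, of j] acg_a_pos[OF assms, of j] by simp
    then have "?c * (acg_A \<mu> L j + acg_a \<mu> L j) \<le> (acg_a \<mu> L j)\<^sup>2"
      using assms(1) by (simp add: field_simps)
    from sqrt_increment[OF acg_A_nonneg[OF assms] acg_a_pos[OF assms] _ this] Suc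
    show ?case
      using assms(1) unfolding acg_A_Suc by (simp add: distrib_right)
  qed simp
  then have "(real j * (sqrt ?c / 2))\<^sup>2 \<le> (sqrt (acg_A \<mu> L j))\<^sup>2"
    using assms(1) by (intro power_mono) auto
  then show ?thesis
    using assms(1) acg_A_nonneg[OF assms, of j] by (simp add: power_mult_distrib power_divide)
qed

text \<open>Convexity and smoothness of \<open>g\<close> enter through two quadratic bounds, the
  upper one with the curvature used in \<open>acg_Gamma\<close>. The starting point is placed in
  \<open>Rn n\<close> rather than in \<open>edom n h\<close>, because the restarted method can leave
  the domain.\<close>

locale acg =
  fixes n :: nat and g :: "fvec \<Rightarrow> real" and h :: "fvec \<Rightarrow> ereal" and \<mu> L :: real
    and x0 :: fvec and x y yt :: "nat \<Rightarrow> fvec"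
  assumes h: "proper_closed_convex n h"
    and L: "0 < L" and \<mu>: "0 \<le> \<mu>"
    and lower: "\<And>u z. u \<in> Rn n \<Longrightarrow> z \<in> Rn n \<Longrightarrow> lin n g u z + \<mu> / 2 * (norm (u - z))\<^sup>2 \<le> g u"
    and upper: "\<And>u z. u \<in> Rn n \<Longrightarrow> z \<in> Rn n \<Longrightarrow>
      g u \<le> lin n g u z + (2 * L + \<mu>) / 2 * (norm (u - z))\<^sup>2"
    and x0: "x0 \<in> Rn n"
    and run: "acg_run n g h \<mu> L x0 x y yt"
begin

abbreviation "A \<equiv> acg_A \<mu> L"
abbreviation "a \<equiv> acg_a \<mu> L"
abbreviation "\<tau> \<equiv> acg_tau \<mu> L"
abbreviation "xt \<equiv> acg_xt \<mu> L x y"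
abbreviation "\<psi> u \<equiv> g u + real_of_ereal (h u)"
abbreviation "\<Gamma> j u \<equiv> real_of_ereal (acg_Gamma n g h \<mu> L (xt j) u)"
abbreviation "\<theta> j \<equiv> acg_theta n g h \<mu> L (xt j) (yt (Suc j))"
abbreviation "\<Theta> \<equiv> acg_Theta n g h \<mu> L x y yt"
abbreviation "s \<equiv> acg_s \<mu> L x0 x"

section \<open>Iterates and models of one ACG run\<close>

lemma run_0: "x 0 = x0" "y 0 = x0"
  using run by (auto simp: acg_run_def)

lemma yt_min: "is_arg_min (acg_Gamma n g h \<mu> L (xt j)) (\<lambda>u. u \<in> Rn n) (yt (Suc j))"
  using run by (auto simp: acg_run_def)

lemma y_min: "is_arg_min (objective g h) (\<lambda>u. u \<in> {y j, yt (Suc j)}) (y (Suc j))"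
  using run by (auto simp: acg_run_def)

lemma x_Suc: "\<tau> (Suc j) *\<^sub>R x (Suc j) =
  ((2 * L + \<mu>) * a j) *\<^sub>R yt (Suc j) - (2 * A j * a j * L / A (Suc j)) *\<^sub>R y j"
proof -
  have "x (Suc j) = (1 / (A (Suc j) * \<mu> + 1)) *\<^sub>R
      (((2 * L + \<mu>) * a j) *\<^sub>R yt (Suc j) - (2 * A j * a j * L / A (Suc j)) *\<^sub>R y j)"
    using run unfolding acg_run_def by blast
  moreover have "\<tau> (Suc j) = A (Suc j) * \<mu> + 1" "\<tau> (Suc j) \<noteq> 0"
    using acg_tau_ge_1[OF L \<mu>, of "Suc j"] acg_tau_eq[of \<mu> L "Suc j"] by (simp_all add: mult.commute)
  ultimately show ?thesis by simp
qed

lemma yt_edom: "yt (Suc j) \<in> edom n h"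
  by (rule acg_Gamma_growth(1)[OF h yt_min])

lemma y_Rn: "y j \<in> Rn n"
proof (induction j)
  case (Suc j)
  then show ?case
    using arg_min_pair(1)[OF h y_min _ yt_edom] edomD by blast
qed (simp add: run_0 x0)

lemma y_Suc_edom: "y (Suc j) \<in> edom n h"
  by (rule arg_min_pair(1)[OF h y_min y_Rn yt_edom])

lemma y_edom: "1 \<le> j \<Longrightarrow> y j \<in> edom n h"
  using y_Suc_edom[of "j - 1"] by simp

lemma x_Rn: "x j \<in> Rn n"
proof (cases j)
  case (Suc i)
  have "\<tau> j *\<^sub>R x j \<in> Rn n"
    unfolding Suc x_Suc using edomD[OF yt_edom] y_Rn by (intro Rn_intros)
  then have "(1 / \<tau> j) *\<^sub>R \<tau> j *\<^sub>R x j \<in> Rn n"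
    by (rule subspace_scale[OF subspace_Rn])
  then show ?thesis
    using acg_tau_ge_1[OF L \<mu>, of j] by simp
qed (simp add: run_0 x0)

lemma xt_Rn: "xt j \<in> Rn n"
  unfolding acg_xt_def using x_Rn y_Rn by (intro Rn_intros)

text \<open>Growth of \<open>\<Gamma> j\<close> from its minimizer leaves the linearization plus
  \<open>h u\<close> plus \<open>\<mu> / 2\<close> times the squared distance to
  \<open>xt j\<close>, which strong convexity bounds by psi.\<close>

lemma theta_le: 
  assumes "u \<in> edom n h"
  shows "\<theta> j u \<le> \<psi> u"
  using acg_Gamma_growth(2)[OF h yt_min assms, of j] lower[OF edomD[OF assms] xt_Rn, of j]
  unfolding acg_theta_eq acg_Gamma_edom[OF h assms] by (simp add: field_simps)

text \<open>The factor \<open>A j\<close> makes the induction start: \<open>\<Theta> 0\<close> is 0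
  by convention and need not lie below psi.\<close>

lemma Theta_le:
  assumes "u \<in> edom n h"
  shows "A j * \<Theta> j u \<le> A j * \<psi> u"
proof (induction j)
  case (Suc j)
  have "A (Suc j) * \<Theta> (Suc j) u = A j * \<Theta> j u + a j * \<theta> j u"
    using acg_A_pos[OF L \<mu>, of "Suc j"] by simp
  also have "\<dots> \<le> A j * \<psi> u + a j * \<psi> u"
    using acg_a_pos[OF L \<mu>, of j]
    by (intro add_mono Suc mult_left_mono[OF theta_le[OF assms]]) simp
  finally show ?case
    by (simp only: acg_A_Suc distrib_right)
qed simp

text \<open>Both properties go through one induction, since the bound at \<open>Suc j\<close> comes
  from evaluating the merged quadratic at its new centre.\<close>

lemma Theta_quadratic:
  obtains m where "A j * \<psi> (y j) \<le> m"
    and "\<And>u. A j * \<Theta> j u + 1 / 2 * (norm (u - x0))\<^sup>2 = m + \<tau> j / 2 * (norm (u - x j))\<^sup>2"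
proof (induction j arbitrary: thesis)
  case 0
  then show ?case by (simp add: run_0)
next
  case (Suc j)
  obtain m where m: "A j * \<psi> (y j) \<le> m"
      "\<And>u. A j * \<Theta> j u + 1 / 2 * (norm (u - x0))\<^sup>2 = m + \<tau> j / 2 * (norm (u - x j))\<^sup>2"
    using Suc.IH by blast
  let ?p = "yt (Suc j)" and ?U = "(2 * L) *\<^sub>R (xt j - yt (Suc j))"
  define c where "c = \<Gamma> j ?p - L * (norm (?p - xt j))\<^sup>2"
  have \<theta>: "\<theta> j u = c + ?U \<bullet> (u - ?p) + \<mu> / 2 * (norm (u - ?p))\<^sup>2" for u
    by (simp add: acg_theta_def c_def)
  have A': "A (Suc j) = A j + a j" "0 < A (Suc j)"
    using acg_A_Suc acg_A_pos[OF L \<mu>, of "Suc j"] by auto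
  \<comment> \<open>By the step equation the component of \<open>a j *\<^sub>R ?U\<close> along
    \<open>x j\<close> is exactly \<open>\<tau> j *\<^sub>R x j\<close>; it cancels, leaving the
    explicit update of \<open>x (Suc j)\<close>.\<close>
  have "a j * (2 * L * (a j / A (Suc j))) = \<tau> j"
    using acg_a_sq[OF L \<mu>, of j] A' by (simp add: field_simps power2_eq_square)
  then have "\<tau> (Suc j) *\<^sub>R x (Suc j) = \<tau> j *\<^sub>R x j + (a j * \<mu>) *\<^sub>R ?p - a j *\<^sub>R ?U"
    unfolding x_Suc acg_xt_def by (simp add: algebra_simps)
  from quadratic_merge[OF acg_tau_Suc this] obtain m0 where m0:
    "\<And>u. \<tau> j / 2 * (norm (u - x j))\<^sup>2 + a j * (?U \<bullet> (u - ?p) + \<mu> / 2 * (norm (u - ?p))\<^sup>2)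
      = m0 + \<tau> (Suc j) / 2 * (norm (u - x (Suc j)))\<^sup>2" by blast
  let ?m = "m + a j * c + m0"
  have step: "m + \<tau> j / 2 * (norm (u - x j))\<^sup>2 + a j * \<theta> j u
      = ?m + \<tau> (Suc j) / 2 * (norm (u - x (Suc j)))\<^sup>2" for u
    using m0[of u] unfolding \<theta> by (simp add: algebra_simps)
  \<comment> \<open>For \<open>j = 0\<close> the point \<open>y j\<close> may lie outside the
    domain, but the factor \<open>A 0 = 0\<close> removes it.\<close>
  have "A j * \<theta> j (y j) \<le> m"
  proof (cases "j = 0")
    case False
    then have "A j * \<theta> j (y j) \<le> A j * \<psi> (y j)"
      using theta_le[OF y_edom, of j j] acg_A_nonneg[OF L \<mu>, of j] by (intro mult_left_mono) auto
    with m(1) show ?thesis by simp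
  qed (use m(1) in simp)
  \<comment> \<open>The penalty restores the term subtracted in \<open>acg_theta_eq\<close>, so the
    minimum of \<open>\<Gamma> j\<close> can serve as the \<open>\<beta>\<close> of
    \<open>estimate_step\<close>.\<close>
  moreover have "\<Gamma> j ?p \<le> \<theta> j \<xi> + 2 * L / 2 * (norm (\<xi> - xt j))\<^sup>2" for \<xi>
    unfolding acg_theta_eq using L \<mu> by simp
  ultimately have "(A j + a j) * \<Gamma> j ?p \<le> m + \<tau> j / 2 * (norm (x (Suc j) - x j))\<^sup>2 + a j * \<theta> j (x (Suc j))"
    unfolding \<theta> using acg_A_nonneg[OF L \<mu>] acg_a_pos[OF L \<mu>] \<mu> acg_a_sq[OF L \<mu>]
    by (intro estimate_step[of _ _ _ "2 * L" _ _ "y j"]) (auto simp: acg_xt_def A'(1) simp del: acg_A.simps)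
  then have "A (Suc j) * \<Gamma> j ?p \<le> ?m"
    unfolding step A'(1) by simp
  moreover have "A (Suc j) * \<psi> (y (Suc j)) \<le> A (Suc j) * \<Gamma> j ?p"
    using arg_min_pair(2)[OF h y_min y_Rn yt_edom, of j] upper[OF edomD[OF yt_edom] xt_Rn, of j j] A'(2)
    unfolding acg_Gamma_edom[OF h yt_edom] by (intro mult_left_mono) auto
  moreover have "A (Suc j) * \<Theta> (Suc j) u + 1 / 2 * (norm (u - x0))\<^sup>2
      = ?m + \<tau> (Suc j) / 2 * (norm (u - x (Suc j)))\<^sup>2" for u
  proof -
    have "A (Suc j) * \<Theta> (Suc j) u = A j * \<Theta> j u + a j * \<theta> j u"
      using A'(2) by simp
    then show ?thesis
      using m(2)[of u] step[of u] by simp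
  qed
  ultimately show ?case
    using Suc.prems by (meson order_trans)
qed

text \<open>Stationarity of \<open>A j * \<Theta> j\<close> plus half the squared distance to
  \<open>x0\<close> at its minimizer makes \<open>s j\<close> the gradient of
  \<open>\<Theta> j\<close> at \<open>x j\<close>; the curvature comes from
  \<open>\<tau> j = 1 + \<mu> * A j\<close>.\<close>

lemma Theta_expand:
  assumes "1 \<le> j"
  shows "\<Theta> j u = \<Theta> j (x j) + s j \<bullet> (u - x j) + \<mu> / 2 * (norm (u - x j))\<^sup>2"
proof -
  obtain m where m:
    "\<And>u. A j * \<Theta> j u + 1 / 2 * (norm (u - x0))\<^sup>2 = m + \<tau> j / 2 * (norm (u - x j))\<^sup>2"
    using Theta_quadratic by blast
  have pos: "0 < A j" by (rule acg_A_pos[OF L \<mu> assms])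
  have "A j * (s j \<bullet> (u - x j)) = - ((u - x j) \<bullet> (x j - x0))"
    using pos by (simp add: acg_s_def inner_diff_left inner_diff_right inner_commute algebra_simps)
  moreover have "\<tau> j / 2 * (norm (u - x j))\<^sup>2
      = 1 / 2 * (norm (u - x j))\<^sup>2 + A j * (\<mu> / 2 * (norm (u - x j))\<^sup>2)"
    by (simp add: acg_tau_eq field_simps)
  moreover have "A j * \<Theta> j (x j) + 1 / 2 * (norm (x j - x0))\<^sup>2 = m"
    using m[of "x j"] by simp
  ultimately have "A j * \<Theta> j u = A j * (\<Theta> j (x j) + s j \<bullet> (u - x j) + \<mu> / 2 * (norm (u - x j))\<^sup>2)"
    using m[of u] norm_sq_expand[of u x0 "x j"] unfolding distrib_left by linarith
  then show ?thesis using pos by simp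
qed

lemma gap_le:
  "A j * (\<psi> (y j) - \<Theta> j (x j)) \<le> 1 / 2 * (norm (x j - x0))\<^sup>2"
proof -
  obtain m where m: "A j * \<psi> (y j) \<le> m"
    "\<And>u. A j * \<Theta> j u + 1 / 2 * (norm (u - x0))\<^sup>2 = m + \<tau> j / 2 * (norm (u - x j))\<^sup>2"
    using Theta_quadratic by blast
  show ?thesis
    using m(1) m(2)[of "x j"] by (simp add: right_diff_distrib)
qed

text \<open>\<open>gap_le\<close> measures \<open>x j\<close> while the stopping test measures
  \<open>y j\<close>. Evaluating the quadratic at \<open>y j\<close>, where
  \<open>\<Theta> j\<close> is below psi, shows that \<open>y j\<close> is at least as close to
  \<open>x j\<close> as to \<open>x0\<close>.\<close>

lemma x_dist_le:
  assumes "1 \<le> j"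
  shows "norm (x j - x0) \<le> 2 * norm (y j - x0)"
proof -
  obtain m where m: "A j * \<psi> (y j) \<le> m"
    "\<And>u. A j * \<Theta> j u + 1 / 2 * (norm (u - x0))\<^sup>2 = m + \<tau> j / 2 * (norm (u - x j))\<^sup>2"
    using Theta_quadratic by blast
  have "\<tau> j * (norm (y j - x j))\<^sup>2 \<le> (norm (y j - x0))\<^sup>2"
    using m(1) m(2)[of "y j"] Theta_le[OF y_edom[OF assms], of j] by linarith
  moreover have "(norm (y j - x j))\<^sup>2 \<le> \<tau> j * (norm (y j - x j))\<^sup>2"
    using mult_right_mono[OF acg_tau_ge_1[OF L \<mu>, of j] zero_le_power2[of "norm (y j - x j)"]]
    by simp
  ultimately have "(norm (y j - x j))\<^sup>2 \<le> (norm (y j - x0))\<^sup>2"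
    by linarith
  then have "norm (y j - x j) \<le> norm (y j - x0)"
    by (rule power2_le_imp_le) simp
  moreover have "norm (x j - x0) \<le> norm (y j - x0) + norm (y j - x j)"
    using norm_triangle_ineq4[of "y j - x0" "y j - x j"] by simp
  ultimately show ?thesis
    by linarith
qed

section \<open>The stopping test\<close>

lemma racg_stop_iff:
  assumes "1 \<le> j"
  shows "racg_stop n g h \<mu> L \<sigma> lam x0 x y yt j \<longleftrightarrow>
    (norm (lam *\<^sub>R s j))\<^sup>2 + 2 * lam * (\<psi> (y j) - \<Theta> j (x j)) \<le> \<sigma> * (norm (y j - x0))\<^sup>2"
  using assms unfolding racg_stop_def objective_edom[OF h y_edom[OF assms]] by simp

text \<open>The left-hand side is at most \<open>?q^2 + ?q \<le> 2 * ?q\<close> times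
  \<open>?r\<close>, and \<open>x_dist_le\<close> costs a factor 4; hence the 8.\<close>

lemma racg_stopI:
  assumes j: "1 \<le> j" and \<sigma>: "0 < \<sigma>" "\<sigma> < 1" and lam: "0 < lam" and A: "8 * lam / \<sigma> \<le> A j"
  shows "racg_stop n g h \<mu> L \<sigma> lam x0 x y yt j"
proof -
  let ?r = "(norm (x j - x0))\<^sup>2" and ?q = "lam / A j"
  have pos: "0 < A j" by (rule acg_A_pos[OF L \<mu> j])
  have q: "0 \<le> ?q" "?q \<le> \<sigma> / 8" "?q \<le> 1"
  proof -
    show "0 \<le> ?q" "?q \<le> \<sigma> / 8"
      using lam pos A \<sigma> by (auto simp: field_simps)
    then show "?q \<le> 1" using \<sigma> by linarith
  qed
  have "(norm (lam *\<^sub>R s j))\<^sup>2 = ?q\<^sup>2 * ?r"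
    by (simp add: acg_s_def power_mult_distrib power_divide norm_minus_commute)
  moreover have "2 * lam * (\<psi> (y j) - \<Theta> j (x j)) \<le> ?q * ?r"
    using mult_left_mono[OF gap_le[of j], of "2 * ?q"] q(1) pos by simp
  ultimately have "(norm (lam *\<^sub>R s j))\<^sup>2 + 2 * lam * (\<psi> (y j) - \<Theta> j (x j)) \<le> (?q\<^sup>2 + ?q) * ?r"
    by (simp add: distrib_right)
  also have "\<dots> \<le> (\<sigma> / 4) * ?r"
  proof (rule mult_right_mono)
    have "?q\<^sup>2 \<le> ?q * 1"
      unfolding power2_eq_square using q by (intro mult_left_mono)
    then show "?q\<^sup>2 + ?q \<le> \<sigma> / 4" using q(2) by linarith
  qed simp
  also have "\<dots> \<le> (\<sigma> / 4) * (2 * norm (y j - x0))\<^sup>2"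
    using \<sigma> x_dist_le[OF j] by (intro mult_left_mono power_mono) auto
  finally show ?thesis
    unfolding racg_stop_iff[OF j] by (simp add: power_mult_distrib)
qed

end

section \<open>Restarted ACG\<close>

lemma racg_step_pos:
  assumes "0 < lam" "0 \<le> B" "0 < \<tau>"
  shows "0 < racg_step lam B \<tau>"
  using assms by (auto simp: racg_step_def intro!: add_pos_nonneg)

lemma racg_step_sq:
  assumes "0 < lam" "0 \<le> B" "0 < \<tau>"
  shows "(racg_step lam B \<tau>)\<^sup>2 = \<tau> * lam * (B + racg_step lam B \<tau>)"
proof -
  define r where "r = sqrt (\<tau>\<^sup>2 * lam\<^sup>2 + 4 * \<tau> * lam * B)"
  have r: "r\<^sup>2 = \<tau>\<^sup>2 * lam\<^sup>2 + 4 * \<tau> * lam * B"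
    unfolding r_def using assms by simp
  have "((\<tau> * lam + r) / 2)\<^sup>2 = ((\<tau> * lam)\<^sup>2 + 2 * (\<tau> * lam) * r + r\<^sup>2) / 4"
    by (simp add: power2_eq_square field_simps)
  also have "\<dots> = \<tau> * lam * (B + (\<tau> * lam + r) / 2)"
    unfolding r by (simp add: power2_eq_square field_simps)
  finally show ?thesis
    unfolding racg_step_def r_def .
qed

lemma racg_tau_eq: "racg_tau \<mu>f lam k = 1 + \<mu>f * racg_B \<mu>f lam k"
  by (induction k) (auto simp: distrib_left)

lemma racg_B_nonneg: "0 < lam \<Longrightarrow> 0 \<le> \<mu>f \<Longrightarrow> 0 \<le> racg_B \<mu>f lam k"
proof (induction k)
  case (Suc k)
  then show ?case
    using racg_step_pos[of lam "racg_B \<mu>f lam k" "racg_tau \<mu>f lam k"]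
    by (simp add: racg_tau_eq add_pos_nonneg)
qed simp

lemma racg_tau_ge_1: "0 < lam \<Longrightarrow> 0 \<le> \<mu>f \<Longrightarrow> 1 \<le> racg_tau \<mu>f lam k"
  by (simp add: racg_tau_eq racg_B_nonneg)

lemma racg_b_pos: "0 < lam \<Longrightarrow> 0 \<le> \<mu>f \<Longrightarrow> 0 < racg_b \<mu>f lam k"
  unfolding racg_b_def using racg_tau_ge_1[of lam \<mu>f k] by (intro racg_step_pos racg_B_nonneg) auto

lemma racg_b_sq:
  "0 < lam \<Longrightarrow> 0 \<le> \<mu>f \<Longrightarrow>
    (racg_b \<mu>f lam k)\<^sup>2 = racg_tau \<mu>f lam k * lam * (racg_B \<mu>f lam k + racg_b \<mu>f lam k)"
  unfolding racg_b_def using racg_tau_ge_1[of lam \<mu>f k] by (intro racg_step_sq racg_B_nonneg) auto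

lemma racg_B_Suc: "racg_B \<mu>f lam (Suc k) = racg_B \<mu>f lam k + racg_b \<mu>f lam k"
  by (simp add: racg_b_def)

lemma racg_tau_Suc: "racg_tau \<mu>f lam (Suc k) = racg_tau \<mu>f lam k + racg_b \<mu>f lam k * \<mu>f"
  by (simp add: racg_b_def)

lemma racg_B_quadratic:
  assumes "0 < lam" "0 \<le> \<mu>f"
  shows "lam * (real k)\<^sup>2 / 4 \<le> racg_B \<mu>f lam k"
proof -
  have "real k * (sqrt lam / 2) \<le> sqrt (racg_B \<mu>f lam k)"
  proof (induction k)
    case (Suc k)
    let ?B = "racg_B \<mu>f lam k" and ?b = "racg_b \<mu>f lam k"
    have "lam * (?B + ?b) \<le> racg_tau \<mu>f lam k * (lam * (?B + ?b))"
      using mult_right_mono[OF racg_tau_ge_1[OF assms, of k], of "lam * (?B + ?b)"]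
        racg_B_nonneg[OF assms, of k] racg_b_pos[OF assms, of k] assms by simp
    then have "lam * (?B + ?b) \<le> ?b\<^sup>2"
      unfolding racg_b_sq[OF assms] by (simp only: mult.assoc)
    from sqrt_increment[OF racg_B_nonneg[OF assms] racg_b_pos[OF assms] _ this] Suc
    show ?case
      using assms(1) unfolding racg_B_Suc by (simp add: distrib_right)
  qed simp
  then have "(real k * (sqrt lam / 2))\<^sup>2 \<le> (sqrt (racg_B \<mu>f lam k))\<^sup>2"
    using assms(1) by (intro power_mono) auto
  then show ?thesis
    using assms(1) racg_B_nonneg[OF assms, of k]
    by (simp add: power_mult_distrib power_divide mult.commute)
qed

text \<open>Since \<open>racg_tau\<close> exceeds \<open>\<mu>f * racg_B\<close>, the step equation
  makes each step at least \<open>sqrt (\<mu>f * lam)\<close> times the current sum. The index is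
  shifted because the sum is 0 at index 0 and \<open>lam\<close> at index 1.\<close>

lemma racg_B_geometric:
  assumes "0 < lam" "0 \<le> \<mu>f"
  shows "lam * (1 + sqrt (\<mu>f * lam)) ^ k \<le> racg_B \<mu>f lam (Suc k)"
proof (induction k)
  case 0
  then show ?case using assms by (simp add: racg_step_def)
next
  case (Suc k)
  let ?B = "racg_B \<mu>f lam (Suc k)" and ?b = "racg_b \<mu>f lam (Suc k)" and ?s = "sqrt (\<mu>f * lam)"
  note B = racg_B_nonneg[OF assms, of "Suc k"] and b = racg_b_pos[OF assms, of "Suc k"]
  have "(?s * ?B)\<^sup>2 = (\<mu>f * ?B) * (lam * ?B)"
    using assms by (simp add: power_mult_distrib power2_eq_square)
  also have "\<dots> \<le> racg_tau \<mu>f lam (Suc k) * (lam * (?B + ?b))"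
    using assms B b racg_tau_eq[of \<mu>f lam "Suc k"] by (intro mult_mono mult_left_mono) auto
  also have "\<dots> = ?b\<^sup>2"
    unfolding racg_b_sq[OF assms] by (simp only: mult.assoc)
  finally have "?s * ?B \<le> ?b"
    by (rule power2_le_imp_le) (use b in simp)
  then have "(1 + ?s) * ?B \<le> racg_B \<mu>f lam (Suc (Suc k))"
    unfolding racg_B_Suc[of _ _ "Suc k"] distrib_right by simp
  moreover have "lam * (1 + ?s) ^ Suc k \<le> (1 + ?s) * ?B"
    using mult_left_mono[OF Suc, of "1 + ?s"] assms by (simp add: mult_ac)
  ultimately show ?case by (rule order_trans[rotated])
qed

locale racg =
  fixes n :: nat and f :: "fvec \<Rightarrow> real" and h :: "fvec \<Rightarrow> ereal" and \<mu>f Lf \<sigma> lam :: real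
    and w0 :: fvec and w v :: "nat \<Rightarrow> fvec" and x y yt :: "nat \<Rightarrow> nat \<Rightarrow> fvec"
  assumes problem: "composite_problem n f h \<mu>f Lf" and w0: "w0 \<in> edom n h"
    and \<sigma>: "0 < \<sigma>" "\<sigma> < 1" and lam: "0 < lam"
    and run: "racg_run n f h \<mu>f Lf \<sigma> lam w0 w v x y yt"
begin

abbreviation "B \<equiv> racg_B \<mu>f lam"
abbreviation "b \<equiv> racg_b \<mu>f lam"
abbreviation "\<tau> \<equiv> racg_tau \<mu>f lam"
abbreviation "vt \<equiv> racg_vt \<mu>f lam w v"
abbreviation "\<mu> \<equiv> \<mu>f + 1 / lam"
abbreviation "L \<equiv> Lf - \<mu>f"
abbreviation "J \<equiv> racg_inner_iterations n f h \<mu>f Lf \<sigma> lam w v x y yt"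
abbreviation "\<phi> u \<equiv> f u + real_of_ereal (h u)"

section \<open>Inner calls of the restarted method\<close>

lemma h: "proper_closed_convex n h" and \<mu>f: "0 \<le> \<mu>f" and L: "0 < L" and \<mu>f_le: "\<mu>f \<le> L"
  using problem by (auto simp: composite_problem_def)

lemma run_0: "w 0 = w0" "v 0 = w0"
  using run by (auto simp: racg_run_def)

lemma run_acg: "acg_run n (racg_g f lam (vt k)) h \<mu> L (vt k) (x k) (y k) (yt k)"
  using run by (auto simp: racg_run_def Let_def)

lemma w_min: "is_arg_min (objective f h) (\<lambda>u. u \<in> {w k, y k (J k)}) (w (Suc k))"
  using run unfolding racg_run_def Let_def by blast

lemma v_Suc: "\<tau> (Suc k) *\<^sub>R v (Suc k) = \<tau> k *\<^sub>R v k + (b k * \<mu>f) *\<^sub>R x k (J k)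
  - b k *\<^sub>R ((acg_A \<mu> L (J k) + lam) / lam) *\<^sub>R acg_s \<mu> L (vt k) (x k) (J k)"
proof -
  have "v (Suc k) = (1 / \<tau> (Suc k)) *\<^sub>R (\<tau> k *\<^sub>R v k + (b k * \<mu>f) *\<^sub>R x k (J k)
      - (b k * ((acg_A \<mu> L (J k) + lam) / lam)) *\<^sub>R acg_s \<mu> L (vt k) (x k) (J k))"
    using run unfolding racg_run_def Let_def by blast
  moreover have "\<tau> (Suc k) \<noteq> 0"
    using racg_tau_ge_1[OF lam \<mu>f, of "Suc k"] by simp
  ultimately show ?thesis
    by (simp del: racg_tau.simps)
qed

lemma inner_acg:
  assumes "vt k \<in> Rn n"
  shows "acg n (racg_g f lam (vt k)) h \<mu> L (vt k) (x k) (y k) (yt k)"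
proof
  have f: "strongly_convex n \<mu>f f" "smooth n Lf f"
    using problem by (auto simp: composite_problem_def)
  fix u z assume uz: "u \<in> Rn n" "z \<in> Rn n"
  let ?N = "(norm (u - z))\<^sup>2"
  note G = smooth_has_grad[OF f(2) uz(2)]
  have lin: "lin n (racg_g f lam (vt k)) u z + c / 2 * ?N
      = lin n f u z + (c - 1 / lam) / 2 * ?N + 1 / (2 * lam) * (norm (u - vt k))\<^sup>2" for c
    unfolding lin_racg_g[OF G uz(2) assms less_imp_neq[OF lam, symmetric]]
    using lam by (simp add: field_simps)
  show "lin n (racg_g f lam (vt k)) u z + \<mu> / 2 * ?N \<le> racg_g f lam (vt k) u"
    using strongly_convex_lower[OF f(1) G uz] unfolding lin by (simp add: racg_g_def)
  \<comment> \<open>With the proximal curvature \<open>1 / lam\<close> removed, the upper bound asks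
    for \<open>Lf \<le> 2 * L + \<mu>f\<close>, where \<open>Lf = L + \<mu>f\<close>.\<close>
  have "Lf / 2 * ?N \<le> (2 * L + \<mu> - 1 / lam) / 2 * ?N"
    using \<mu>f \<mu>f_le by (intro mult_right_mono) auto
  then show "racg_g f lam (vt k) u \<le> lin n (racg_g f lam (vt k)) u z + (2 * L + \<mu>) / 2 * ?N"
    using smooth_upper[OF f(2) uz] unfolding lin by (simp add: racg_g_def)
qed (use h L \<mu>f lam assms run_acg in auto)

lemma stops_at:
  assumes "vt k \<in> Rn n" "1 \<le> j" "8 * sqrt (L * lam / \<sigma>) \<le> real j"
  shows "racg_stops_at n f h \<mu>f Lf \<sigma> lam w v x y yt k j"
proof -
  interpret inner: acg n "racg_g f lam (vt k)" h \<mu> L "vt k" "x k" "y k" "yt k"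
    by (rule inner_acg[OF assms(1)])
  have "(8 * sqrt (L * lam / \<sigma>))\<^sup>2 \<le> (real j)\<^sup>2"
    using assms(3) L lam \<sigma> by (intro power_mono) auto
  then have "8 * lam / \<sigma> \<le> (real j)\<^sup>2 / (8 * L)"
    using L lam \<sigma> by (simp add: power_mult_distrib field_simps)
  also have "\<dots> \<le> acg_A \<mu> L j"
    using L \<mu>f lam by (intro acg_A_lower) auto
  finally show ?thesis
    unfolding racg_stops_at_def by (rule inner.racg_stopI[OF assms(2) \<sigma> lam])
qed

lemma stops:
  assumes "vt k \<in> Rn n"
  shows "racg_stops_at n f h \<mu>f Lf \<sigma> lam w v x y yt k (J k)"
  unfolding racg_inner_iterations_def
proof (rule LeastI)
  \<comment> \<open>\<open>Suc\<close> secures \<open>1 \<le> j\<close> for any positive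
    \<open>lam\<close>.\<close>
  show "racg_stops_at n f h \<mu>f Lf \<sigma> lam w v x y yt k (Suc (nat \<lceil>8 * sqrt (L * lam / \<sigma>)\<rceil>))"
    by (rule stops_at[OF assms]) linarith+
qed

text \<open>The 9 is the 8 of \<open>stops_at\<close> plus 1 for rounding up:
  \<open>\<sigma> < 1 \<le> L * lam\<close> makes the square root at least 1.\<close>

lemma inner_iterations_le:
  assumes "vt k \<in> Rn n" "1 / L \<le> lam"
  shows "real (J k) \<le> 9 * sqrt (L * lam / \<sigma>)"
proof -
  let ?r = "sqrt (L * lam / \<sigma>)"
  have "\<sigma> \<le> L * lam"
    using assms(2) L \<sigma> by (simp add: field_simps)
  then have r: "1 \<le> ?r"
    using \<sigma> by simp
  then have "racg_stops_at n f h \<mu>f Lf \<sigma> lam w v x y yt k (nat \<lceil>8 * ?r\<rceil>)"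
    by (intro stops_at assms) linarith+
  then have "J k \<le> nat \<lceil>8 * ?r\<rceil>"
    unfolding racg_inner_iterations_def by (rule Least_le)
  then show ?thesis
    using r by linarith
qed

text \<open>\<open>m\<close> plus the quadratic around \<open>v k\<close> is the accumulated sum of
  models \<open>q\<close> plus half the squared distance to \<open>w0\<close>; only its upper bound
  through \<open>\<phi>\<close> is kept. The location of the iterates belongs to the induction
  because the inner analysis needs \<open>vt k\<close> in \<open>Rn n\<close>.\<close>

lemma invariant:
  "w k \<in> edom n h \<and> v k \<in> Rn n \<and>
    (\<exists>m. B k * \<phi> (w k) \<le> m \<and>
      (\<forall>u\<in>edom n h. m + \<tau> k / 2 * (norm (u - v k))\<^sup>2 \<le> B k * \<phi> u + 1 / 2 * (norm (u - w0))\<^sup>2))"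
proof (induction k)
  case 0
  then show ?case using w0 by (auto simp: run_0 edom_def)
next
  case (Suc k)
  then obtain m where w: "w k \<in> edom n h" and v: "v k \<in> Rn n" and m: "B k * \<phi> (w k) \<le> m"
    "\<And>u. u \<in> edom n h \<Longrightarrow>
      m + \<tau> k / 2 * (norm (u - v k))\<^sup>2 \<le> B k * \<phi> u + 1 / 2 * (norm (u - w0))\<^sup>2"
    by blast
  note Bk = racg_B_nonneg[OF lam \<mu>f, of k] and bk = racg_b_pos[OF lam \<mu>f, of k]
  have vt: "vt k \<in> Rn n"
    unfolding racg_vt_def using edomD[OF w] v by (intro Rn_intros)
  interpret inner: acg n "racg_g f lam (vt k)" h \<mu> L "vt k" "x k" "y k" "yt k"
    by (rule inner_acg[OF vt])
  let ?x = "x k (J k)" and ?y = "y k (J k)" and ?c = "vt k" and ?s = "inner.s (J k)"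
  let ?\<Theta> = "inner.\<Theta> (J k)"
  have J: "1 \<le> J k"
    using stops[OF vt] by (auto simp: racg_stops_at_def racg_stop_def)
  have A: "0 < inner.A (J k)"
    by (rule acg_A_pos[OF inner.L inner.\<mu> J])
  have y: "?y \<in> edom n h"
    by (rule inner.y_edom[OF J])
  have "(norm (lam *\<^sub>R ?s))\<^sup>2 + 2 * lam * (racg_g f lam ?c ?y + real_of_ereal (h ?y) - ?\<Theta> ?x)
      \<le> \<sigma> * (norm (?y - ?c))\<^sup>2"
    using stops[OF vt] unfolding racg_stops_at_def inner.racg_stop_iff[OF J] .
  moreover have "2 * lam * (racg_g f lam ?c ?y + real_of_ereal (h ?y) - ?\<Theta> ?x)
      = 2 * lam * (\<phi> ?y - ?\<Theta> ?x) + (norm (?y - ?c))\<^sup>2"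
    using lam by (simp add: racg_g_def right_diff_distrib distrib_left)
  moreover have "\<sigma> * (norm (?y - ?c))\<^sup>2 \<le> 1 * (norm (?y - ?c))\<^sup>2"
    using \<sigma> by (intro mult_right_mono) auto
  ultimately have stop: "(norm (lam *\<^sub>R ?s))\<^sup>2 + 2 * lam * (\<phi> ?y - ?\<Theta> ?x) \<le> 0"
    by linarith
  \<comment> \<open>\<open>U\<close> and \<open>c\<close> are the gradient and the value at
    \<open>?x\<close> of \<open>?\<Theta>\<close> minus the proximal term. As \<open>?c - ?x\<close>
    is \<open>inner.A (J k)\<close> times \<open>?s\<close>, this gradient is the vector in the
    update of \<open>v\<close>. The curvature drops from \<open>\<mu>\<close> to
    \<open>\<mu>f\<close>.\<close>
  define U where "U = ((inner.A (J k) + lam) / lam) *\<^sub>R ?s"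
  define c where "c = ?\<Theta> ?x - 1 / (2 * lam) * (norm (?x - ?c))\<^sup>2"
  define q where "q u = c + U \<bullet> (u - ?x) + \<mu>f / 2 * (norm (u - ?x))\<^sup>2" for u
  have q_eq: "q u + 1 / (2 * lam) * (norm (u - ?c))\<^sup>2 = ?\<Theta> u" for u
  proof -
    have "?c - ?x = inner.A (J k) *\<^sub>R ?s"
      using A by (simp add: acg_s_def)
    then have "U = ?s + (1 / lam) *\<^sub>R (?c - ?x)"
      using lam by (simp add: U_def add_divide_distrib scaleR_add_left)
    moreover have "(?c - ?x) \<bullet> (u - ?x) = - ((u - ?x) \<bullet> (?x - ?c))"
      by (simp add: inner_commute[of "u - ?x"] flip: inner_minus_left)
    ultimately have "U \<bullet> (u - ?x) = ?s \<bullet> (u - ?x) - 1 / lam * ((u - ?x) \<bullet> (?x - ?c))"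
      by (simp add: inner_add_left)
    moreover have "(norm (u - ?c))\<^sup>2 - (norm (?x - ?c))\<^sup>2
        = (norm (u - ?x))\<^sup>2 + 2 * ((u - ?x) \<bullet> (?x - ?c))"
      using norm_sq_expand[of u ?c ?x] by linarith
    moreover have "1 / (2 * lam) * (N + 2 * D) = 1 / lam / 2 * N + 1 / lam * D" for N D :: real
      by (simp add: distrib_left)
    ultimately have *: "U \<bullet> (u - ?x) + 1 / (2 * lam) * ((norm (u - ?c))\<^sup>2 - (norm (?x - ?c))\<^sup>2)
        = ?s \<bullet> (u - ?x) + 1 / lam / 2 * (norm (u - ?x))\<^sup>2"
      by (simp only:)
    have "q u + 1 / (2 * lam) * (norm (u - ?c))\<^sup>2 = ?\<Theta> ?x + \<mu>f / 2 * (norm (u - ?x))\<^sup>2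
        + (U \<bullet> (u - ?x) + 1 / (2 * lam) * ((norm (u - ?c))\<^sup>2 - (norm (?x - ?c))\<^sup>2))"
      unfolding q_def c_def right_diff_distrib by simp
    also have "\<dots> = ?\<Theta> u"
      unfolding * inner.Theta_expand[OF J, of u] by (simp add: add_divide_distrib distrib_right)
    finally show ?thesis .
  qed
  have q_le: "q u \<le> \<phi> u" if "u \<in> edom n h" for u
    using inner.Theta_le[OF that, of "J k"] A q_eq[of u] by (simp add: racg_g_def)
  \<comment> \<open>Curvature \<open>\<mu> \<ge> 1 / lam\<close> bounds \<open>?\<Theta>\<close>
    below by \<open>?\<Theta> ?x - lam / 2 * (norm ?s)^2\<close>, found by completing the square;
    \<open>stop\<close> puts \<open>\<phi> ?y\<close> below that value.\<close>
  have \<beta>: "\<phi> ?y \<le> q \<xi> + (1 / lam) / 2 * (norm (\<xi> - ?c))\<^sup>2" for \<xi>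
  proof -
    let ?d = "\<xi> - ?x"
    have "0 \<le> (norm (lam *\<^sub>R ?s + ?d))\<^sup>2" by simp
    also have "\<dots> = (norm (lam *\<^sub>R ?s))\<^sup>2 + 2 * lam * (?s \<bullet> ?d) + (norm ?d)\<^sup>2"
      using dot_norm[of "lam *\<^sub>R ?s" ?d] by simp
    also have "\<dots> \<le> (norm (lam *\<^sub>R ?s))\<^sup>2 + 2 * lam * (?s \<bullet> ?d) + (lam * \<mu>) * (norm ?d)\<^sup>2"
    proof -
      have "1 \<le> lam * \<mu>"
        using lam \<mu>f by (simp add: distrib_left)
      from mult_right_mono[OF this, of "(norm ?d)\<^sup>2"] show ?thesis by simp
    qed
    also have "\<dots> = (norm (lam *\<^sub>R ?s))\<^sup>2 + 2 * lam * (?\<Theta> \<xi> - ?\<Theta> ?x)"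
    proof -
      have "?\<Theta> \<xi> - ?\<Theta> ?x = ?s \<bullet> ?d + \<mu> / 2 * (norm ?d)\<^sup>2"
        using inner.Theta_expand[OF J, of \<xi>] by simp
      moreover have "2 * lam * (P + M / 2 * N) = 2 * lam * P + lam * M * N" for P M N :: real
        by (simp add: distrib_left)
      ultimately show ?thesis by (simp only: add.assoc)
    qed
    also have "\<dots> \<le> 2 * lam * (?\<Theta> \<xi> - \<phi> ?y)"
      using stop unfolding right_diff_distrib by linarith
    finally show ?thesis
      using lam q_eq[of \<xi>] by (simp add: zero_le_mult_iff)
  qed
  have "B k * q (w k) \<le> m"
    using mult_left_mono[OF q_le[OF w] Bk] m(1) by linarith
  then have step: "(B k + b k) * \<phi> ?y \<le> m + \<tau> k / 2 * (norm (u - v k))\<^sup>2 + b k * q u" for u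
    unfolding q_def
  proof (intro estimate_step[of _ _ _ "1 / lam" _ "?c" "w k"])
    show "1 / lam * (b k)\<^sup>2 = \<tau> k * (B k + b k)"
      unfolding racg_b_sq[OF lam \<mu>f] using lam by simp
    show "?c = (B k / (B k + b k)) *\<^sub>R w k + (b k / (B k + b k)) *\<^sub>R v k"
      unfolding racg_vt_def racg_B_Suc ..
  qed (use Bk bk \<mu>f \<beta> in \<open>simp_all only: q_def\<close>)
  obtain m0 where m0:
    "\<And>u. \<tau> k / 2 * (norm (u - v k))\<^sup>2 + b k * (U \<bullet> (u - ?x) + \<mu>f / 2 * (norm (u - ?x))\<^sup>2)
      = m0 + \<tau> (Suc k) / 2 * (norm (u - v (Suc k)))\<^sup>2"
    using quadratic_merge[OF racg_tau_Suc v_Suc[of k, folded U_def]] by blast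
  let ?m = "m + b k * c + m0"
  have merge: "m + \<tau> k / 2 * (norm (u - v k))\<^sup>2 + b k * q u
      = ?m + \<tau> (Suc k) / 2 * (norm (u - v (Suc k)))\<^sup>2" for u
    using m0[of u] unfolding q_def by (simp add: distrib_left)
  have w': "w (Suc k) \<in> edom n h" "\<phi> (w (Suc k)) \<le> \<phi> ?y"
    by (rule arg_min_pair[OF h w_min edomD[OF w] y])+
  have "B (Suc k) * \<phi> (w (Suc k)) \<le> (B k + b k) * \<phi> ?y"
    unfolding racg_B_Suc using w'(2) Bk bk by (intro mult_left_mono) auto
  also have "\<dots> \<le> ?m"
    using step[of "v (Suc k)"] unfolding merge by simp
  finally have "B (Suc k) * \<phi> (w (Suc k)) \<le> ?m" .
  moreover have "?m + \<tau> (Suc k) / 2 * (norm (u - v (Suc k)))\<^sup>2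
      \<le> B (Suc k) * \<phi> u + 1 / 2 * (norm (u - w0))\<^sup>2" if "u \<in> edom n h" for u
    using m(2)[OF that] mult_left_mono[OF q_le[OF that], of "b k"] bk
    unfolding merge[symmetric] racg_B_Suc distrib_right by linarith
  moreover have "v (Suc k) \<in> Rn n"
  proof -
    have "\<tau> (Suc k) *\<^sub>R v (Suc k) \<in> Rn n"
      unfolding v_Suc acg_s_def using v vt inner.x_Rn by (intro Rn_intros)
    then have "(1 / \<tau> (Suc k)) *\<^sub>R \<tau> (Suc k) *\<^sub>R v (Suc k) \<in> Rn n"
      by (rule subspace_scale[OF subspace_Rn])
    then show ?thesis
      using racg_tau_ge_1[OF lam \<mu>f, of "Suc k"] by (simp del: racg_tau.simps)
  qed
  ultimately show ?case
    using w'(1) by blast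
qed

section \<open>From the invariant to eps-solutions\<close>

lemma w_edom: "w k \<in> edom n h"
  using invariant by blast

lemma vt_Rn: "vt k \<in> Rn n"
  unfolding racg_vt_def using edomD[OF w_edom] invariant by (intro Rn_intros) auto

lemma minimizers_edom: "minimizers n f h \<subseteq> edom n h"
proof
  fix u assume "u \<in> minimizers n f h"
  then have "u \<in> Rn n" "objective f h u \<le> objective f h w0"
    using edomD[OF w0] by (auto simp: minimizers_def is_arg_min_def not_less)
  then show "u \<in> edom n h"
    unfolding objective_edom[OF h w0] by (auto simp: objective_def edom_def)
qed

lemma convergence:
  assumes "u \<in> minimizers n f h"
  shows "B k * (\<phi> (w k) - \<phi> u) \<le> 1 / 2 * (norm (w0 - u))\<^sup>2"
proof -
  have u: "u \<in> edom n h" using assms minimizers_edom by blast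
  obtain m where "B k * \<phi> (w k) \<le> m"
    "m + \<tau> k / 2 * (norm (u - v k))\<^sup>2 \<le> B k * \<phi> u + 1 / 2 * (norm (u - w0))\<^sup>2"
    using invariant[of k] u by blast
  moreover have "0 \<le> \<tau> k / 2 * (norm (u - v k))\<^sup>2"
    using racg_tau_ge_1[OF lam \<mu>f, of k] by simp
  ultimately show ?thesis
    unfolding norm_minus_commute[of w0] right_diff_distrib by linarith
qed

lemma eps_solution_iff:
  assumes "u \<in> minimizers n f h"
  shows "eps_solution n f h \<epsilon> (w k) \<longleftrightarrow> \<phi> (w k) - \<phi> u \<le> \<epsilon>"
proof -
  have u: "u \<in> edom n h" using assms minimizers_edom by blast
  have "(INF x\<in>Rn n. objective f h x) = objective f h u"
  proof (rule antisym)
    show "(INF x\<in>Rn n. objective f h x) \<le> objective f h u"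
      using edomD[OF u] by (rule INF_lower)
    show "objective f h u \<le> (INF x\<in>Rn n. objective f h x)"
      using assms by (intro INF_greatest) (auto simp: minimizers_def is_arg_min_def not_less)
  qed
  then show ?thesis
    unfolding eps_solution_def using edomD[OF w_edom[of k]]
    by (simp add: objective_edom[OF h u] objective_edom[OF h w_edom])
qed

lemma R0_nonneg: "0 \<le> R0 n f h w0"
  unfolding R0_def using problem by (intro cINF_greatest) (auto simp: composite_problem_def)

text \<open>\<open>convergence\<close> holds for every minimizer and all minimizers share one
  objective value, so the resulting lower bound on the distance passes to the infimum
  \<open>R0\<close>.\<close>

lemma eps_solution_if:
  assumes "0 < \<epsilon>" "0 < R0 n f h w0" "(R0 n f h w0)\<^sup>2 / \<epsilon> \<le> B k"
  shows "eps_solution n f h \<epsilon> (w k)"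
proof (rule ccontr)
  assume not: "\<not> ?thesis"
  have ne: "minimizers n f h \<noteq> {}"
    using problem by (auto simp: composite_problem_def)
  have "0 < (R0 n f h w0)\<^sup>2 / \<epsilon>"
    using assms(1,2) by simp
  then have Bk: "0 < B k"
    using assms(3) by linarith
  obtain u where u: "u \<in> minimizers n f h" using ne by blast
  define \<delta> where "\<delta> = \<phi> (w k) - \<phi> u"
  have \<delta>: "\<epsilon> < \<delta>" 
    using not eps_solution_iff[OF u] by (simp add: \<delta>_def)
  have "sqrt (2 * B k * \<delta>) \<le> norm (w0 - u')" if u': "u' \<in> minimizers n f h" for u'
  proof -
    have "\<phi> a \<le> \<phi> b" if "a \<in> minimizers n f h" "b \<in> minimizers n f h" for a b
    proof -
      have "a \<in> edom n h" "b \<in> edom n h"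
        using that minimizers_edom by auto
      moreover have "objective f h a \<le> objective f h b"
        using that by (simp add: minimizers_def is_arg_min_def not_less)
      ultimately show ?thesis
        by (simp add: objective_edom[OF h])
    qed
    from this[OF u u'] this[OF u' u] have "\<phi> u = \<phi> u'"
      by simp
    then have "B k * \<delta> \<le> 1 / 2 * (norm (w0 - u'))\<^sup>2"
      using convergence[OF u', of k] by (simp add: \<delta>_def)
    then show ?thesis
      by (intro real_le_lsqrt) auto
  qed
  then have "sqrt (2 * B k * \<delta>) \<le> R0 n f h w0"
    unfolding R0_def by (intro cINF_greatest ne)
  then have "(sqrt (2 * B k * \<delta>))\<^sup>2 \<le> (R0 n f h w0)\<^sup>2"
    using Bk \<delta> assms(1) by (intro power_mono) auto
  then have "2 * (B k * \<delta>) \<le> (R0 n f h w0)\<^sup>2"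
    using Bk \<delta> assms(1) by simp
  also have "\<dots> \<le> B k * \<epsilon>"
    using assms by (simp add: field_simps)
  also have "\<dots> \<le> B k * \<delta>"
    using Bk \<delta> by (intro mult_left_mono) auto
  finally have "B k * \<delta> \<le> 0" by linarith
  then show False
    using Bk \<delta> assms(1) by (simp add: mult_le_0_iff)
qed

lemma finds:
  assumes "0 < \<epsilon>" "0 < R0 n f h w0" "1 / L \<le> lam" "(R0 n f h w0)\<^sup>2 / \<epsilon> \<le> B k"
  shows "racg_finds n f h \<mu>f Lf \<sigma> lam \<epsilon> w v x y yt (real k * (9 * sqrt (L * lam / \<sigma>)))"
proof -
  define K where "K = (LEAST k. eps_solution n f h \<epsilon> (w k))"
  have k: "eps_solution n f h \<epsilon> (w k)"
    by (rule eps_solution_if[OF assms(1,2,4)])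
  have "K \<le> k"
    unfolding K_def by (rule Least_le[where P = "\<lambda>k. eps_solution n f h \<epsilon> (w k)", OF k])
  have "real (\<Sum>k<K. J k) = (\<Sum>k<K. real (J k))"
    by simp
  also have "\<dots> \<le> (\<Sum>k<K. 9 * sqrt (L * lam / \<sigma>))"
    by (intro sum_mono inner_iterations_le vt_Rn assms(3))
  also have "\<dots> = real K * (9 * sqrt (L * lam / \<sigma>))"
    by simp
  also have "\<dots> \<le> real k * (9 * sqrt (L * lam / \<sigma>))"
    using \<open>K \<le> k\<close> L lam \<sigma> by (intro mult_right_mono) auto
  finally have "real (\<Sum>k<K. J k) \<le> real k * (9 * sqrt (L * lam / \<sigma>))" .
  moreover have "eps_solution n f h \<epsilon> (w K)"
    unfolding K_def by (rule LeastI[where P = "\<lambda>k. eps_solution n f h \<epsilon> (w k)", OF k])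
  moreover have "\<forall>k<K. \<not> eps_solution n f h \<epsilon> (w k)"
    unfolding K_def using not_less_Least by blast
  ultimately show ?thesis
    unfolding racg_finds_def using stops[OF vt_Rn] by blast
qed

section \<open>Total iteration counts\<close>

lemma finds_mono:
  assumes "racg_finds n f h \<mu>f Lf \<sigma> lam \<epsilon> w v x y yt N" "N \<le> N'"
  shows "racg_finds n f h \<mu>f Lf \<sigma> lam \<epsilon> w v x y yt N'"
  using assms unfolding racg_finds_def by (meson order_trans)

lemma R0_pos:
  assumes "0 < \<epsilon>" "lam \<le> (R0 n f h w0)\<^sup>2 / \<epsilon>"
  shows "0 < R0 n f h w0"
  using assms lam R0_nonneg by (cases "R0 n f h w0 = 0") auto

lemma finds_sublinear:
  assumes \<epsilon>: "0 < \<epsilon>" and lam_ge: "1 / L \<le> lam" and lam_le: "lam \<le> (R0 n f h w0)\<^sup>2 / \<epsilon>"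
  shows "racg_finds n f h \<mu>f Lf \<sigma> lam \<epsilon> w v x y yt
    (27 / sqrt \<sigma> * (R0 n f h w0 * sqrt (Lf / \<epsilon>)))"
proof -
  let ?R = "R0 n f h w0"
  note R = R0_pos[OF \<epsilon> lam_le]
  \<comment> \<open>\<open>2 * r\<close> restarts bring the quadratic lower bound on
    \<open>B\<close> to \<open>?R^2 / \<epsilon>\<close>. Since \<open>1 \<le> r\<close>, rounding
    up costs at most another \<open>r\<close>, and 27 = 3 * 9.\<close>
  define r where "r = ?R / sqrt (lam * \<epsilon>)"
  have r2: "r\<^sup>2 = ?R\<^sup>2 / (lam * \<epsilon>)"
    using \<epsilon> lam by (simp add: r_def power_divide)
  have "0 \<le> r"
    using R \<epsilon> lam by (simp add: r_def)
  moreover have "1 \<le> r\<^sup>2"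
    unfolding r2 using lam_le \<epsilon> lam by (simp add: field_simps)
  ultimately have r: "1 \<le> r"
    by (metis one_power2 power2_le_imp_le)
  define k where "k = nat \<lceil>2 * r\<rceil>"
  have k: "2 * r \<le> real k" "real k \<le> 3 * r"
    using r unfolding k_def by linarith+
  have "?R\<^sup>2 / \<epsilon> = lam * (2 * r)\<^sup>2 / 4"
    using lam by (simp add: power_mult_distrib r2)
  also have "\<dots> \<le> lam * (real k)\<^sup>2 / 4"
    using k(1) r lam by (intro divide_right_mono mult_left_mono power_mono) auto
  also have "\<dots> \<le> B k"
    by (rule racg_B_quadratic[OF lam \<mu>f])
  finally have "racg_finds n f h \<mu>f Lf \<sigma> lam \<epsilon> w v x y yt (real k * (9 * sqrt (L * lam / \<sigma>)))"
    by (rule finds[OF \<epsilon> R lam_ge])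
  then show ?thesis
  proof (rule finds_mono)
    have "real k * (9 * sqrt (L * lam / \<sigma>)) \<le> 3 * r * (9 * sqrt (Lf * lam / \<sigma>))"
      using k(2) r L lam \<sigma> \<mu>f
      by (intro mult_mono mult_left_mono real_sqrt_le_mono divide_right_mono mult_right_mono) auto
    also have "\<dots> = 27 / sqrt \<sigma> * (?R * sqrt (Lf / \<epsilon>))"
      using lam by (simp add: r_def real_sqrt_mult real_sqrt_divide)
    finally show "real k * (9 * sqrt (L * lam / \<sigma>)) \<le> 27 / sqrt \<sigma> * (?R * sqrt (Lf / \<epsilon>))" .
  qed
qed

lemma finds_linear:
  assumes \<epsilon>: "0 < \<epsilon>" and pos: "0 < \<mu>f" and lam_ge: "1 / L \<le> lam"
    and lam_le: "lam \<le> 1 / \<mu>f" "lam \<le> (R0 n f h w0)\<^sup>2 / \<epsilon>"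
  shows "racg_finds n f h \<mu>f Lf \<sigma> lam \<epsilon> w v x y yt
    (36 / sqrt \<sigma> * sqrt (Lf / \<mu>f) * log_factor \<mu>f Lf lam (R0 n f h w0) \<epsilon>)"
proof -
  let ?R = "R0 n f h w0" and ?l = "log_factor \<mu>f Lf lam (R0 n f h w0) \<epsilon>"
  note R = R0_pos[OF \<epsilon> lam_le(2)]
  define s where "s = sqrt (\<mu>f * lam)"
  \<comment> \<open>The absolute value makes \<open>d\<close> nonnegative at once. The square of
    \<open>?R\<close> is the reason for the factor 2 in \<open>1 + d \<le> 2 * ?l\<close>.\<close>
  define d where "d = \<bar>ln (?R\<^sup>2 / (lam * \<epsilon>))\<bar>"
  have s: "0 < s" "s \<le> 1"
    using pos lam lam_le(1) by (auto simp: s_def field_simps)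
  have "0 \<le> d"
    by (simp add: d_def)
  have "ln (?R\<^sup>2 / (lam * \<epsilon>)) = 2 * ln ?R - ln lam - ln \<epsilon>"
    using R lam \<epsilon> by (simp add: ln_div ln_mult ln_realpow)
  then have "d \<le> 2 * \<bar>ln ?R\<bar> + \<bar>ln lam\<bar> + \<bar>ln \<epsilon>\<bar>"
    unfolding d_def by linarith
  moreover have "0 \<le> 1 + 2 * \<bar>ln \<mu>f\<bar> + 2 * \<bar>ln Lf\<bar> + \<bar>ln lam\<bar> + \<bar>ln \<epsilon>\<bar>"
    by (simp add: add_nonneg_nonneg)
  then have "1 + (2 * \<bar>ln ?R\<bar> + \<bar>ln lam\<bar> + \<bar>ln \<epsilon>\<bar>) \<le> 2 * ?l"
    unfolding log_factor_def by argo
  ultimately have "1 + d \<le> 2 * ?l"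
    by (meson add_left_mono order_trans)
  note d = \<open>0 \<le> d\<close> this
  \<comment> \<open>Since \<open>ln (1 + s) \<ge> s / 2\<close> for \<open>s \<le> 1\<close>, this
    many factors \<open>1 + s\<close> have a logarithm of at least \<open>d\<close>.\<close>
  define k where "k = nat \<lceil>2 / s * d\<rceil>"
  have k: "2 / s * d \<le> real k" "real k \<le> 2 / s * d + 1"
    unfolding k_def using s d(1) by (simp_all add: real_nat_ceiling_ge ceiling_correct)
  have "s / 2 \<le> ln (1 + s)"
  proof -
    have "s / 2 \<le> 1 - 1 / (1 + s)"
      using s by (simp add: field_simps)
    also have "\<dots> \<le> ln (1 + s)"
      using ln_le_minus_one[of "1 / (1 + s)"] s by (simp add: ln_div)
    finally show ?thesis .
  qed
  then have "real k * (s / 2) \<le> real k * ln (1 + s)"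
    by (intro mult_left_mono) auto
  moreover have "d \<le> real k * (s / 2)"
    using k(1) s by (simp add: field_simps)
  ultimately have "ln (?R\<^sup>2 / (lam * \<epsilon>)) \<le> ln ((1 + s) ^ k)"
    using s by (simp add: d_def ln_realpow)
  then have "?R\<^sup>2 / (lam * \<epsilon>) \<le> (1 + s) ^ k"
    using R lam \<epsilon> s by (subst (asm) ln_le_cancel_iff) auto
  then have "?R\<^sup>2 / \<epsilon> \<le> lam * (1 + s) ^ k"
    using lam \<epsilon> by (simp add: field_simps)
  also have "\<dots> \<le> B (Suc k)"
    unfolding s_def by (rule racg_B_geometric[OF lam \<mu>f])
  finally have "racg_finds n f h \<mu>f Lf \<sigma> lam \<epsilon> w v x y yt
      (real (Suc k) * (9 * sqrt (L * lam / \<sigma>)))"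
    by (rule finds[OF \<epsilon> R lam_ge])
  then show ?thesis
  proof (rule finds_mono)
    \<comment> \<open>Rounding and the index shift of \<open>racg_B_geometric\<close> add 2, which
      is at most \<open>2 / s\<close>; then 36 = 2 * 2 * 9.\<close>
    have "real (Suc k) \<le> 2 / s * (1 + d)"
      using k(2) s by (simp add: field_simps)
    also have "\<dots> \<le> 2 / s * (2 * ?l)"
      using d(2) s by (intro mult_left_mono) auto
    finally have "real (Suc k) * (9 * sqrt (L * lam / \<sigma>)) \<le> 4 / s * ?l * (9 * sqrt (Lf * lam / \<sigma>))"
      using s L lam \<sigma> \<mu>f d
      by (intro mult_mono mult_left_mono real_sqrt_le_mono divide_right_mono mult_right_mono) auto
    also have "\<dots> = 36 / sqrt \<sigma> * sqrt (Lf / \<mu>f) * ?l"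
      using lam by (simp add: s_def real_sqrt_mult real_sqrt_divide mult_ac)
    finally show "real (Suc k) * (9 * sqrt (L * lam / \<sigma>)) \<le> 36 / sqrt \<sigma> * sqrt (Lf / \<mu>f) * ?l" .
  qed
qed

end

theorem theorem2p3:
  shows
    "(\<exists>(C :: real \<Rightarrow> real) (p :: nat). \<forall>n f h \<mu>f Lf \<sigma> lam \<epsilon> w0 w v x y yt.
        composite_problem n f h \<mu>f Lf \<and> w0 \<in> edom n h \<and>
        0 < \<sigma> \<and> \<sigma> < 1 \<and> 0 < lam \<and> 0 < \<epsilon> \<and>
        racg_run n f h \<mu>f Lf \<sigma> lam w0 w v x y yt \<and>
        \<mu>f = 0 \<and> 1 / Lf \<le> lam \<and> lam \<le> (R0 n f h w0)\<^sup>2 / \<epsilon>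
        \<longrightarrow> racg_finds n f h \<mu>f Lf \<sigma> lam \<epsilon> w v x y yt
              (C \<sigma> * (R0 n f h w0 * sqrt (Lf / \<epsilon>))
                * log_factor \<mu>f Lf lam (R0 n f h w0) \<epsilon> ^ p))
     \<and>
     (\<exists>(C :: real \<Rightarrow> real) (p :: nat). \<forall>n f h \<mu>f Lf \<sigma> lam \<epsilon> w0 w v x y yt.
        composite_problem n f h \<mu>f Lf \<and> w0 \<in> edom n h \<and>
        0 < \<sigma> \<and> \<sigma> < 1 \<and> 0 < lam \<and> 0 < \<epsilon> \<and>
        racg_run n f h \<mu>f Lf \<sigma> lam w0 w v x y yt \<and>
        0 < \<mu>f \<and> 1 / (Lf - \<mu>f) \<le> lam \<and> lam \<le> min (1 / \<mu>f) ((R0 n f h w0)\<^sup>2 / \<epsilon>)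
        \<longrightarrow> racg_finds n f h \<mu>f Lf \<sigma> lam \<epsilon> w v x y yt
              (C \<sigma> * min (sqrt (Lf / \<mu>f)) (R0 n f h w0 * sqrt (Lf / \<epsilon>))
                * log_factor \<mu>f Lf lam (R0 n f h w0) \<epsilon> ^ p))"
\<comment> \<open>\<open>C\<close> and \<open>p\<close> stay schematic until each
  \<open>show\<close> fixes them. Being introduced before the parameters, they depend on none of
  them, apart from \<open>\<sigma>\<close> as the argument of \<open>C\<close>.\<close>
proof (rule conjI; (intro exI allI impI)?)
  fix n f h \<mu>f Lf \<sigma> lam \<epsilon> w0 w v x y yt
  let ?R = "R0 n f h w0"
  assume *: "composite_problem n f h \<mu>f Lf \<and> w0 \<in> edom n h \<and>
    0 < \<sigma> \<and> \<sigma> < 1 \<and> 0 < lam \<and> 0 < \<epsilon> \<and>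
    racg_run n f h \<mu>f Lf \<sigma> lam w0 w v x y yt \<and>
    \<mu>f = 0 \<and> 1 / Lf \<le> lam \<and> lam \<le> ?R\<^sup>2 / \<epsilon>"
  then interpret racg n f h \<mu>f Lf \<sigma> lam w0 w v x y yt
    by unfold_locales auto
  show "racg_finds n f h \<mu>f Lf \<sigma> lam \<epsilon> w v x y yt
      (27 / sqrt \<sigma> * (?R * sqrt (Lf / \<epsilon>)) * log_factor \<mu>f Lf lam ?R \<epsilon> ^ 0)"
    using finds_sublinear[of \<epsilon>] * by simp
next
  fix n f h \<mu>f Lf \<sigma> lam \<epsilon> w0 w v x y yt
  let ?R = "R0 n f h w0"
  let ?l = "log_factor \<mu>f Lf lam ?R \<epsilon>"
  assume *: "composite_problem n f h \<mu>f Lf \<and> w0 \<in> edom n h \<and>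
    0 < \<sigma> \<and> \<sigma> < 1 \<and> 0 < lam \<and> 0 < \<epsilon> \<and>
    racg_run n f h \<mu>f Lf \<sigma> lam w0 w v x y yt \<and>
    0 < \<mu>f \<and> 1 / (Lf - \<mu>f) \<le> lam \<and> lam \<le> min (1 / \<mu>f) (?R\<^sup>2 / \<epsilon>)"
  then interpret racg n f h \<mu>f Lf \<sigma> lam w0 w v x y yt
    by unfold_locales auto
  show "racg_finds n f h \<mu>f Lf \<sigma> lam \<epsilon> w v x y yt
      (36 / sqrt \<sigma> * min (sqrt (Lf / \<mu>f)) (?R * sqrt (Lf / \<epsilon>)) * ?l ^ 1)"
  \<comment> \<open>The smaller of the two bounds is used; the sublinear one is brought to the
    common form by \<open>1 \<le> ?l\<close> and 27 \<le> 36.\<close>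
  proof (cases "sqrt (Lf / \<mu>f) \<le> ?R * sqrt (Lf / \<epsilon>)")
    case True
    then show ?thesis
      using finds_linear[of \<epsilon>] * by simp
  next
    case False
    have "27 / sqrt \<sigma> * (?R * sqrt (Lf / \<epsilon>)) * 1 \<le> 36 / sqrt \<sigma> * (?R * sqrt (Lf / \<epsilon>)) * ?l"
    proof (intro mult_mono)
      show "1 \<le> ?l" by (simp add: log_factor_def)
    qed (use * R0_nonneg L \<mu>f in \<open>auto simp: divide_right_mono\<close>)
    then show ?thesis
      using finds_mono[OF finds_sublinear[of \<epsilon>]] * False by simp
  qed
qed

end
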